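(* Let $G$ be a group and let $N$ be a normal subgroup of $G$ which is a virtual retract of $G$. If $N$ is finitely generated and virtually abelian then there is a monomorphism $\iota: G \to G/N \times A$, where $A$ is a finitely generated virtually abelian group. In particular, if $G/N$ has (LR) then $G$ also has (LR).
   Context: A subgroup $H$ of a group $G$ is a virtual retract of $G$ if there is a finite index subgroup $K$ of $G$ such that $H \subseteq K$ and there is a homomorphism $\rho: K \to H$ whose restriction to $H$ is the identity map. A group $G$ has property (LR) if every finitely generated subgroup of $G$ is a virtual retract of $G$. *)

theory Defs
  imports "HOL-Algebra.Algebra"
begin

definition finite_index_subgroup :: "'a set \<Rightarrow> ('a, 'b) monoid_scheme \<Rightarrow> bool" where
  "finite_index_subgroup H G \<longleftrightarrow> subgroup H G \<and> finite (rcosets\<^bsub>G\<^esub> H)"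

definition fin_gen_group :: "('a, 'b) monoid_scheme \<Rightarrow> bool" where
  "fin_gen_group G \<longleftrightarrow>
     group G \<and> (\<exists>S. finite S \<and> S \<subseteq> carrier G \<and> generate G S = carrier G)"

definition virtually_abelian :: "('a, 'b) monoid_scheme \<Rightarrow> bool" where
  "virtually_abelian G \<longleftrightarrow>
     group G \<and> (\<exists>H. finite_index_subgroup H G \<and> comm_group (G\<lparr>carrier := H\<rparr>))"

definition virtual_retract :: "'a set \<Rightarrow> ('a, 'b) monoid_scheme \<Rightarrow> bool" where
  "virtual_retract H G \<longleftrightarrow>
     subgroup H G \<and>
     (\<exists>K. finite_index_subgroup K G \<and> H \<subseteq> K \<and>
       (\<exists>\<rho> \<in> hom (G\<lparr>carrier := K\<rparr>) (G\<lparr>carrier := H\<rparr>). \<forall>h\<in>H. \<rho> h = h))"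

definition property_LR :: "('a, 'b) monoid_scheme \<Rightarrow> bool" where
  "property_LR G \<longleftrightarrow>
     group G \<and>
     (\<forall>H. subgroup H G \<and> fin_gen_group (G\<lparr>carrier := H\<rparr>) \<longrightarrow> virtual_retract H G)"

end

theory Submission
  imports Defs
begin

text \<open>Replacing \<open>N\<close> by a subgroup \<open>M\<close> of finite index, we may work with a torsion-free, finitely
  generated abelian \<open>M\<close> that is still normal in \<open>G\<close>. After passing to a normal subgroup of finite
  index, the retraction onto \<open>M\<close> has only finitely many conjugates under \<open>G\<close>; their product is
  \<open>G\<close>-equivariant and is a power map on \<open>M\<close>, so its kernel \<open>L\<close> is normal in \<open>G\<close>, meets \<open>N\<close> trivially,
  and \<open>M L\<close> has finite index. Hence \<open>A = G/L\<close> is finitely generated and virtually abelian, and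
  \<open>G\<close> embeds in \<open>G/N \<times> G/L\<close>.

  For property (LR), let \<open>H\<close> be finitely generated. A retraction onto the image of \<open>H\<close> in \<open>G/N\<close>
  pulls back to a subgroup \<open>R \<supseteq> N\<close> normalised by \<open>H\<close> with \<open>R \<inter> H \<subseteq> N\<close> and \<open>H R\<close> of finite index.
  Since \<open>H\<close> acts on \<open>M\<close> through a finite group, the same averaging (as in Maschke's theorem) yields
  an \<open>H\<close>-invariant \<open>P \<subseteq> M\<close> complementing \<open>H \<inter> M\<close> up to finite index, and \<open>P (R \<inter> L)\<close> is then
  the kernel of a retraction of a finite index subgroup onto \<open>H\<close>.\<close>

subsection \<open>Virtual containment of subgroups\<close>

lemma (in group) inv_cancel_left [simp]:
  assumes "x \<in> carrier G" "y \<in> carrier G"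
  shows "inv x \<otimes> (x \<otimes> y) = y" "x \<otimes> (inv x \<otimes> y) = y"
  using assms by (simp_all flip: m_assoc)

lemmas (in group) group_normalize = m_assoc inv_mult_group

lemma set_multI: "\<lbrakk> a \<in> A; b \<in> B \<rbrakk> \<Longrightarrow> a \<otimes>\<^bsub>G\<^esub> b \<in> A <#>\<^bsub>G\<^esub> B"
  by (auto simp: set_mult_def)

lemma set_multE:
  assumes "x \<in> A <#>\<^bsub>G\<^esub> B"
  obtains a b where "a \<in> A" "b \<in> B" "x = a \<otimes>\<^bsub>G\<^esub> b"
  using assms by (auto simp: set_mult_def)

text \<open>For subgroups this says that \<open>H \<inter> K\<close> has finite index in \<open>K\<close>; neither \<open>H \<subseteq> K\<close> nor closure
  under the group operations is assumed.\<close>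

definition virtually_contains :: "('a, 'b) monoid_scheme \<Rightarrow> 'a set \<Rightarrow> 'a set \<Rightarrow> bool" where
  "virtually_contains G H K \<longleftrightarrow> (\<exists>T. finite T \<and> T \<subseteq> carrier G \<and> K \<subseteq> H <#>\<^bsub>G\<^esub> T)"

definition torsion_free_on :: "('a, 'b) monoid_scheme \<Rightarrow> 'a set \<Rightarrow> bool" where
  "torsion_free_on G D \<longleftrightarrow> (\<forall>x\<in>D. \<forall>k>(0::nat). x [^]\<^bsub>G\<^esub> k = \<one>\<^bsub>G\<^esub> \<longrightarrow> x = \<one>\<^bsub>G\<^esub>)"

section \<open>Calculus of virtual containment\<close>

context group begin

text \<open>The finite-valued map \<open>f\<close> plays the role of the coset map: one
  representative from each of its fibres gives the finite set \<open>T\<close>. Finite index is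
  often shown below by exhibiting such a map.\<close>

lemma virtually_containsI:
  assumes "K \<subseteq> carrier G" "finite (f ` K)"
    and "\<And>x y. \<lbrakk> x \<in> K; y \<in> K; f x = f y \<rbrakk> \<Longrightarrow> x \<otimes> inv y \<in> H"
  shows "virtually_contains G H K"
proof -
  let ?T = "inv_into K f ` f ` K"
  have "K \<subseteq> H <#> ?T"
  proof
    fix x assume x: "x \<in> K"
    let ?y = "inv_into K f (f x)"
    have y: "?y \<in> K" "f x = f ?y"
      using x by (auto simp: inv_into_into f_inv_into_f)
    have "x = (x \<otimes> inv ?y) \<otimes> ?y"
      using x y(1) assms(1) by (simp add: m_assoc subsetD)
    then show "x \<in> H <#> ?T"
      using set_multI[OF assms(3)[OF x y]] x by (metis imageI)
  qed
  moreover have "?T \<subseteq> carrier G"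
    using assms(1) by (auto simp: inv_into_into subsetD)
  ultimately show ?thesis
    using assms(2) by (auto simp: virtually_contains_def)
qed

lemma virtually_contains_mono:
  "\<lbrakk> virtually_contains G H K; H \<subseteq> H'; K' \<subseteq> K \<rbrakk> \<Longrightarrow> virtually_contains G H' K'"
  unfolding virtually_contains_def by (meson mono_set_mult order_refl order_trans)

lemma virtually_contains_refl: "K \<subseteq> carrier G \<Longrightarrow> virtually_contains G K K"
  unfolding virtually_contains_def by (rule exI[of _ "{\<one>}"]) (force simp: set_mult_def)

lemma virtually_contains_trans:
  assumes "H \<subseteq> carrier G" "virtually_contains G H K" "virtually_contains G K M"
  shows "virtually_contains G H M"
proof -
  obtain T U where T: "finite T" "T \<subseteq> carrier G" "K \<subseteq> H <#> T"
    and U: "finite U" "U \<subseteq> carrier G" "M \<subseteq> K <#> U"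
    using assms(2,3) by (auto simp: virtually_contains_def)
  have "M \<subseteq> (H <#> T) <#> U"
    using U(3) mono_set_mult[OF T(3) order_refl] by blast
  then have "M \<subseteq> H <#> (T <#> U)"
    using set_mult_assoc[OF assms(1) T(2) U(2)] by simp
  moreover have "finite (T <#> U)"
    using T(1) U(1) by (auto simp: set_mult_def)
  ultimately show ?thesis
    using setmult_subset_G[OF T(2) U(2)] by (auto simp: virtually_contains_def)
qed

lemma virtually_contains_set_mult:
  assumes "A \<subseteq> carrier G" "H \<subseteq> carrier G" "virtually_contains G H K"
  shows "virtually_contains G (A <#> H) (A <#> K)"
proof -
  obtain T where T: "finite T" "T \<subseteq> carrier G" "K \<subseteq> H <#> T"
    using assms(3) by (auto simp: virtually_contains_def)
  have "A <#> K \<subseteq> A <#> H <#> T"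
    using mono_set_mult[OF order_refl T(3)] set_mult_assoc[OF assms(1,2) T(2)] by metis
  then show ?thesis
    using T by (auto simp: virtually_contains_def)
qed

lemma virtually_contains_finite_cosets:
  assumes "subgroup H G" "virtually_contains G H K"
  shows "finite ((\<lambda>x. H #> x) ` K)"
proof -
  obtain T where T: "finite T" "T \<subseteq> carrier G" "K \<subseteq> H <#> T"
    using assms(2) by (auto simp: virtually_contains_def)
  have "(\<lambda>x. H #> x) ` K \<subseteq> (\<lambda>x. H #> x) ` T"
  proof clarify
    fix x assume "x \<in> K"
    then obtain h t where ht: "h \<in> H" "t \<in> T" "x = h \<otimes> t"
      using T(3) by (blast elim: set_multE)
    have H: "H \<subseteq> carrier G" using assms(1) by (rule subgroup.subset)
    have "H #> x = (H #> h) #> t"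
      using ht H T(2) by (simp add: coset_mult_assoc subsetD)
    also have "H #> h = H" using ht(1) H assms(1) by (simp add: coset_join2 subsetD)
    finally show "H #> x \<in> (\<lambda>x. H #> x) ` T" using ht(2) by auto
  qed
  then show ?thesis
    using T(1) finite_subset by blast
qed

lemma r_coset_eqD:
  assumes "subgroup H G" "x \<in> carrier G" "y \<in> carrier G" "H #> x = H #> y"
  shows "x \<otimes> inv y \<in> H"
  using assms subgroup.rcos_module_imp rcos_self by (metis is_group)

lemma virtually_contains_iff_finite_cosets:
  assumes "subgroup H G" "K \<subseteq> carrier G"
  shows "virtually_contains G H K \<longleftrightarrow> finite ((\<lambda>x. H #> x) ` K)"
  using virtually_contains_finite_cosets virtually_containsI[of K "\<lambda>x. H #> x" H]
    r_coset_eqD assms by (metis subsetD)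

lemma finite_index_subgroup_iff:
  "finite_index_subgroup H G \<longleftrightarrow> subgroup H G \<and> virtually_contains G H (carrier G)"
proof -
  have "rcosets H = (\<lambda>x. H #> x) ` carrier G"
    by (auto simp: RCOSETS_def)
  then show ?thesis
    using virtually_contains_iff_finite_cosets[of H "carrier G"]
    by (auto simp: finite_index_subgroup_def)
qed

lemma virtually_contains_subgroupD:
  "\<lbrakk> virtually_contains (G\<lparr>carrier := B\<rparr>) H K; B \<subseteq> carrier G \<rbrakk> \<Longrightarrow> virtually_contains G H K"
  by (auto simp: virtually_contains_def)

lemma virtually_contains_Int:
  assumes H: "subgroup H G" "virtually_contains G H K"
    and M: "subgroup M G" "virtually_contains G M K" and K: "K \<subseteq> carrier G"
  shows "virtually_contains G (H \<inter> M) K"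
proof (rule virtually_containsI[OF K, of "\<lambda>x. (H #> x, M #> x)"])
  have "(\<lambda>x. (H #> x, M #> x)) ` K \<subseteq> ((\<lambda>x. H #> x) ` K) \<times> ((\<lambda>x. M #> x) ` K)"
    by auto
  then show "finite ((\<lambda>x. (H #> x, M #> x)) ` K)"
    using H M virtually_contains_finite_cosets by (meson finite_SigmaI finite_subset)
qed (use assms r_coset_eqD in blast)

text \<open>With \<open>K \<subseteq> H <#> T\<close> one gets
  \<open>A <#> K \<subseteq> A <#> H <#> T \<subseteq> H <#> T\<close>. Combined with transitivity
  this lets finite index be proved one factor at a time.\<close>

lemma virtually_contains_absorb:
  assumes "subgroup H G" "A \<subseteq> H" "virtually_contains G H K"
  shows "virtually_contains G H (A <#> K)"
proof -
  have "A <#> H \<subseteq> H"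
    using assms(1,2) by (auto simp: set_mult_def subgroup.m_closed)
  moreover have "H \<subseteq> carrier G"
    using assms(1) by (rule subgroup.subset)
  ultimately show ?thesis
    using virtually_contains_mono[OF virtually_contains_set_mult[OF _ _ assms(3)], of A H "A <#> K"]
      assms(2) by auto
qed

lemma subgroup_nat_pow_closed:
  "\<lbrakk> subgroup H G; x \<in> H \<rbrakk> \<Longrightarrow> x [^] (n::nat) \<in> H"
  by (induction n) (auto simp: subgroup.one_closed subgroup.m_closed)

text \<open>Pigeonhole: two powers of \<open>x\<close> share a coset, so
  \<open>x [^] d \<in> H\<close> for some \<open>d\<close> between 1 and the number of cosets met by
  \<open>K\<close>. The factorial of that number is divisible by every such \<open>d\<close>, hence
  is an exponent independent of \<open>x\<close>.\<close>

lemma power_mem_subgroup_finite_cosets: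
  assumes H: "subgroup H G" and K: "subgroup K G" and "virtually_contains G H K"
  obtains n where "n > (0::nat)" "\<And>x. x \<in> K \<Longrightarrow> x [^] n \<in> H"
proof -
  let ?C = "(\<lambda>x. H #> x) ` K"
  have fin: "finite ?C"
    using virtually_contains_finite_cosets[OF H assms(3)] .
  have "x [^] (fact (card ?C) :: nat) \<in> H" if x: "x \<in> K" for x
  proof -
    have xc: "x \<in> carrier G" using x K subgroup.subset by blast
    have pow: "x [^] (i::nat) \<in> K" for i
      using x K by (induction i) (auto simp: subgroup.one_closed subgroup.m_closed)
    \<comment> \<open>The exponents start at 0, so there is one more of them than there are
      cosets.\<close>
    have "(\<lambda>i. H #> (x [^] i)) ` {..card ?C} \<subseteq> ?C"
      using pow by auto
    then have "card ((\<lambda>i. H #> (x [^] i)) ` {..card ?C}) \<le> card ?C"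
      using fin card_mono by blast
    then have "\<not> inj_on (\<lambda>i. H #> (x [^] i)) {..card ?C}"
      using card_image by fastforce
    then obtain i j where ij: "i < j" "j \<le> card ?C" "H #> (x [^] i) = H #> (x [^] j)"
      unfolding inj_on_def by (metis atMost_iff linorder_neqE_nat)
    then have "x [^] j \<otimes> inv (x [^] i) \<in> H"
      using r_coset_eqD[OF H] xc by (metis nat_pow_closed)
    moreover have "x [^] j = x [^] (j - i) \<otimes> x [^] i"
      using ij(1) xc by (simp add: nat_pow_mult)
    ultimately have mem: "x [^] (j - i) \<in> H"
      using xc by (simp add: m_assoc)
    have "j - i dvd fact (card ?C)"
      using ij by (intro dvd_fact) auto
    then obtain k where "fact (card ?C) = (j - i) * k" by blast
    then have "x [^] (fact (card ?C) :: nat) = (x [^] (j - i)) [^] k"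
      using xc by (simp add: nat_pow_pow)
    moreover have "(x [^] (j - i)) [^] k \<in> H"
      using mem H by (induction k) (auto simp: subgroup.one_closed subgroup.m_closed)
    ultimately show ?thesis by simp
  qed
  then show thesis using that by (metis fact_gt_zero)
qed

end

subsection \<open>Finitely generated abelian groups\<close>

context comm_group begin

section \<open>Subgroups of powers in abelian groups\<close>

lemma subgroup_powers:
  assumes "subgroup C G"
  shows "subgroup ((\<lambda>x. x [^] (n::nat)) ` C) G"
proof (rule subgroupI)
  have C: "C \<subseteq> carrier G" using assms by (rule subgroup.subset)
  then show "(\<lambda>x. x [^] n) ` C \<subseteq> carrier G" by auto
  show "(\<lambda>x. x [^] n) ` C \<noteq> {}" using assms subgroup.one_closed by blast
  fix a assume "a \<in> (\<lambda>x. x [^] n) ` C"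
  then obtain x where x: "x \<in> C" "a = x [^] n" by auto
  then have "inv a = (inv x) [^] n" using C by (simp add: nat_pow_inv subsetD)
  then show "inv a \<in> (\<lambda>x. x [^] n) ` C" using x(1) assms by (auto simp: subgroup.m_inv_closed)
  fix b assume "b \<in> (\<lambda>x. x [^] n) ` C"
  then obtain y where y: "y \<in> C" "b = y [^] n" by auto
  then have "a \<otimes> b = (x \<otimes> y) [^] n" using x C by (simp add: nat_pow_distrib subsetD)
  then show "a \<otimes> b \<in> (\<lambda>x. x [^] n) ` C" using x(1) y(1) assms by (auto simp: subgroup.m_closed)
qed

lemma set_mult_comm:
  assumes "A \<subseteq> carrier G" "B \<subseteq> carrier G"
  shows "A <#> B = B <#> A"
proof -
  have "a \<otimes> b = b \<otimes> a" if "a \<in> A" "b \<in> B" for a b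
    using assms that by (simp add: m_comm subsetD)
  then show ?thesis by (auto simp: set_mult_def) metis+
qed

lemma generate_insert:
  assumes "s \<in> carrier G" "S \<subseteq> carrier G"
  shows "generate G (insert s S) \<subseteq> generate G {s} <#> generate G S"
proof (rule generate_subgroup_incl)
  have s: "subgroup (generate G {s}) G" and S: "subgroup (generate G S) G"
    using assms generate_is_subgroup by auto
  then show "subgroup (generate G {s} <#> generate G S) G"
    by (rule mult_subgroups)
  have "s = s \<otimes> \<one>" "\<And>t. t \<in> S \<Longrightarrow> t = \<one> \<otimes> t" using assms by auto
  then show "insert s S \<subseteq> generate G {s} <#> generate G S"
    by (metis generate.incl generate.one insertI1 insert_subset set_multI subsetI)
qed

text \<open>Induction on \<open>S\<close>. The powers are taken in all of \<open>carrier G\<close>,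
  so their subgroup stays fixed while \<open>S\<close> grows; a new generator contributes at most
  \<open>n\<close> cosets, one for each residue of its exponent.\<close>

lemma virtually_contains_powers_generate:
  assumes "finite S" "S \<subseteq> carrier G" "n > (0::nat)"
  shows "virtually_contains G ((\<lambda>x. x [^] n) ` carrier G) (generate G S)"
  using assms(1,2)
proof (induction S)
  case empty
  have "generate G {} \<subseteq> (\<lambda>x. x [^] n) ` carrier G"
    by (rule generate_subgroup_incl) (auto intro: subgroup_powers subgroup_self)
  then show ?case
    using virtually_contains_mono[OF virtually_contains_refl[of "(\<lambda>x. x [^] n) ` carrier G"]] by auto
next
  case (insert s S)
  let ?P = "(\<lambda>x. x [^] n) ` carrier G"
  have P: "subgroup ?P G" by (rule subgroup_powers[OF subgroup_self])
  have s: "s \<in> carrier G" using insert by auto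
  have vS: "virtually_contains G ?P (generate G S)" using insert by auto
  have "virtually_contains G ?P (generate G {s})"
  proof (rule virtually_containsI)
    \<comment> \<open>The exponent is not unique when \<open>s\<close> has finite order. Any choice
      serves, since only \<open>x = s [^] k\<close> and the residue modulo \<open>n\<close> are
      used.\<close>
    let ?f = "\<lambda>x. (SOME k::int. x = s [^] k) mod int n"
    show "generate G {s} \<subseteq> carrier G" using s generate_incl by auto
    have "?f ` generate G {s} \<subseteq> {0..<int n}" using assms(3) by auto
    then show "finite (?f ` generate G {s})" using finite_subset by blast
    fix x y assume "x \<in> generate G {s}" "y \<in> generate G {s}" and eq: "?f x = ?f y"
    then have ex: "\<exists>k::int. x = s [^] k" "\<exists>k::int. y = s [^] k"
      using generate_pow[OF s] by auto
    define k l where "k = (SOME k::int. x = s [^] k)" and "l = (SOME k::int. y = s [^] k)"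
    have kl: "x = s [^] k" "y = s [^] l"
      unfolding k_def l_def using someI_ex[OF ex(1)] someI_ex[OF ex(2)] by auto
    have "int n dvd k - l" using eq unfolding k_def l_def by (simp add: mod_eq_dvd_iff)
    then obtain q where "k - l = q * int n" by (metis dvd_def mult.commute)
    then have "x \<otimes> inv y = (s [^] q) [^] n"
      using kl s int_pow_diff[OF s, of k l] by (simp add: int_pow_pow flip: int_pow_int)
    then show "x \<otimes> inv y \<in> ?P" using s by auto
  qed
  \<comment> \<open>Two stages: \<open>generate G {s} <#> generate G S\<close> is reduced to
    \<open>?P <#> generate G S\<close>, with the factors swapped by commutativity, and this is
    reduced to \<open>?P\<close> by the induction hypothesis.\<close>
  then have "virtually_contains G (generate G S <#> ?P) (generate G S <#> generate G {s})"
    using insert.prems subgroup.subset[OF P] generate_incl[of S]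
    by (intro virtually_contains_set_mult) auto
  then have 1: "virtually_contains G (?P <#> generate G S) (generate G {s} <#> generate G S)"
    using set_mult_comm[of ?P "generate G S"] set_mult_comm[of "generate G S" "generate G {s}"]
      generate_incl subgroup.subset[OF P] s insert.prems by auto
  have "virtually_contains G ?P (?P <#> generate G S)"
    using virtually_contains_absorb[OF P order_refl vS] .
  then have "virtually_contains G ?P (generate G {s} <#> generate G S)"
    using 1 virtually_contains_trans subgroup.subset[OF P] by blast
  then show ?case
    using virtually_contains_mono[OF _ order_refl generate_insert] s insert by auto
qed

section \<open>Almost complements in finitely generated abelian groups\<close>

lemma nat_power_mem_if_int_power_mem:
  assumes "subgroup E G" and "x \<in> carrier G" "x [^] (k::int) \<in> E" "k \<noteq> 0"
  shows "\<exists>j>(0::nat). x [^] j \<in> E"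
proof (cases "k > 0")
  case True
  then have "x [^] (nat k) \<in> E" using assms by (simp flip: int_pow_int)
  then show ?thesis using True by (metis zero_less_nat_eq)
next
  case False
  then have "x [^] (nat (- k)) = inv (x [^] k)"
    using assms int_pow_neg[of x k] by (simp flip: int_pow_int)
  then have "x [^] (nat (- k)) \<in> E" using assms by (simp add: subgroup.m_inv_closed)
  then show ?thesis using False assms(4) by (metis neg_0_less_iff_less linorder_neqE zero_less_nat_eq)
qed

text \<open>Greedy construction: a generator is added to \<open>D\<close> unless one of its nontrivial powers
  already lies in \<open>C <#> D\<close>.\<close>

lemma almost_complement_aux:
  assumes C: "subgroup C G" and "finite S" "S \<subseteq> carrier G"
  shows "\<exists>D m. subgroup D G \<and> torsion_free_on G D \<and> C \<inter> D = {\<one>} \<and> m > (0::nat) \<and>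
           (\<forall>s\<in>S. s [^] m \<in> C <#> D)"
  using assms(2,3)
proof (induction S)
  case empty
  have "subgroup {\<one>} G" "torsion_free_on G {\<one>}" "C \<inter> {\<one>} = {\<one>}"
    using triv_subgroup subgroup.one_closed[OF C] by (auto simp: torsion_free_on_def)
  then show ?case by blast
next
  case (insert s S)
  then obtain D m where D: "subgroup D G" "torsion_free_on G D" "C \<inter> D = {\<one>}"
    and m: "m > (0::nat)" "\<And>s. s \<in> S \<Longrightarrow> s [^] m \<in> C <#> D" by auto
  have s: "s \<in> carrier G" using insert by auto
  have E: "subgroup (C <#> D) G" using C D(1) by (rule mult_subgroups)
  have Cc: "C \<subseteq> carrier G" and Dc: "D \<subseteq> carrier G"
    using C D(1) subgroup.subset by auto
  show ?case
  proof (cases "\<exists>k>(0::nat). s [^] k \<in> C <#> D")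
    case True
    then obtain k where k: "k > (0::nat)" "s [^] k \<in> C <#> D" by blast
    have closed: "x [^] (i::nat) \<in> C <#> D" if "x \<in> C <#> D" for x i
      using that E by (induction i) (auto simp: subgroup.one_closed subgroup.m_closed)
    have "t [^] (m * k) \<in> C <#> D" if "t \<in> insert s S" for t
    proof (cases "t = s")
      case True
      then show ?thesis
        using closed[OF k(2), of m] s by (simp add: nat_pow_pow mult.commute)
    next
      case False
      then show ?thesis
        using that closed[OF m(2), of t k] insert.prems by (auto simp: nat_pow_pow)
    qed
    then show ?thesis using D k(1) m(1) by (intro exI[of _ D] exI[of _ "m * k"]) auto
  next
    case False
    \<comment> \<open>If \<open>s [^] k \<otimes> d\<close> is torsion or lies in \<open>C\<close>,
      then some multiple of \<open>k\<close> (or \<open>k\<close> itself) is the exponent of a power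
      of \<open>s\<close> in \<open>C <#> D\<close>. Independence forces \<open>k = 0\<close>, which
      reduces both claims about the enlarged subgroup to those about \<open>D\<close>.\<close>
    then have indep: "k = 0" if "s [^] (k::int) \<in> C <#> D" for k
      using nat_power_mem_if_int_power_mem[OF E s that] by blast
    let ?D = "generate G {s} <#> D"
    have gs: "subgroup (generate G {s}) G" using s generate_is_subgroup by auto
    have D': "subgroup ?D G" using gs D(1) by (rule mult_subgroups)
    have elem: "\<exists>k::int. \<exists>d\<in>D. x = s [^] k \<otimes> d" if "x \<in> ?D" for x
      using that generate_pow[OF s] by (auto elim!: set_multE)
    have D1: "d \<in> ?D" if "d \<in> D" for d
      using set_multI[OF generate.one[of G] that, of G] that Dc by auto
    have "torsion_free_on G ?D"
      unfolding torsion_free_on_def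
    proof (intro ballI allI impI)
      fix x and j :: nat assume x: "x \<in> ?D" and j: "0 < j" "x [^] j = \<one>"
      obtain k :: int and d where kd: "d \<in> D" "x = s [^] k \<otimes> d" using elem[OF x] by blast
      have dc: "d \<in> carrier G" using kd Dc by auto
      have eq: "s [^] (k * int j) \<otimes> d [^] j = \<one>"
        using j(2) kd(2) dc s by (simp add: int_pow_distrib int_pow_pow flip: int_pow_int)
      then have "s [^] (k * int j) = inv (d [^] j)"
        using dc s by (metis inv_equality int_pow_closed nat_pow_closed)
      moreover have dj: "d [^] j \<in> D"
        using kd(1) D(1) by (induction j) (auto simp: subgroup.one_closed subgroup.m_closed)
      ultimately have "s [^] (k * int j) \<in> D" using D(1) by (simp add: subgroup.m_inv_closed)
      then have "s [^] (k * int j) \<in> C <#> D"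
        using set_multI[OF subgroup.one_closed[OF C], of _ D G] s by fastforce
      then have "k = 0" using indep j(1) by fastforce
      then have "x = d" "d [^] j = \<one>" using kd(2) eq dc by auto
      then show "x = \<one>" using D(2) kd(1) j(1) by (auto simp: torsion_free_on_def)
    qed
    moreover have "C \<inter> ?D = {\<one>}"
    proof (intro equalityI subsetI)
      fix x assume "x \<in> C \<inter> ?D"
      then obtain k :: int and d where x: "x \<in> C" and kd: "d \<in> D" "x = s [^] k \<otimes> d"
        using elem by blast
      have dc: "d \<in> carrier G" using kd Dc by auto
      have "s [^] k = x \<otimes> inv d" using kd(2) dc s by (simp add: m_assoc)
      then have "s [^] k \<in> C <#> D"
        using set_multI[OF x subgroup.m_inv_closed[OF D(1) kd(1)], of G] by simp
      then have "k = 0" by (rule indep)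
      then have "x = d" using kd dc by simp
      then show "x \<in> {\<one>}" using D(3) x kd(1) by auto
    qed (use subgroup.one_closed[OF C] subgroup.one_closed[OF D'] in auto)
    moreover have "t [^] m \<in> C <#> ?D" if "t \<in> insert s S" for t
    proof (cases "t = s")
      case True
      have "s [^] m \<in> generate G {s}"
        using gs by (intro subgroup_nat_pow_closed) (auto intro: generate.incl)
      then have "s [^] m \<otimes> \<one> \<in> ?D" using subgroup.one_closed[OF D(1)] by (rule set_multI)
      then show ?thesis
        using True set_multI[OF subgroup.one_closed[OF C], of "s [^] m" ?D G] s by simp
    next
      case False
      have "C <#> D \<subseteq> C <#> ?D" using D1 by (intro mono_set_mult) auto
      then show ?thesis using False that m(2) by blast
    qed
    ultimately show ?thesis using D' m(1) by blast
  qed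
qed

text \<open>The \<open>m\<close>-th power map is a homomorphism, so the elements it sends into the
  subgroup \<open>C <#> D\<close> form a subgroup, and it suffices to control the
  generators.\<close>

lemma almost_complement:
  assumes C: "subgroup C G" and "finite S" "S \<subseteq> carrier G" "generate G S = carrier G"
  shows "\<exists>D m. subgroup D G \<and> torsion_free_on G D \<and> C \<inter> D = {\<one>} \<and> m > (0::nat) \<and>
           (\<forall>x\<in>carrier G. x [^] m \<in> C <#> D)"
proof -
  obtain D m where D: "subgroup D G" "torsion_free_on G D" "C \<inter> D = {\<one>}"
    and m: "m > (0::nat)" "\<And>s. s \<in> S \<Longrightarrow> s [^] m \<in> C <#> D"
    using almost_complement_aux[OF assms(1-3)] by auto
  have E: "subgroup (C <#> D) G" using C D(1) by (rule mult_subgroups)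
  have "x [^] m \<in> C <#> D" if "x \<in> generate G S" for x
    using that
  proof induction
    case one
    show ?case using subgroup.one_closed[OF E] by simp
  next
    case (incl h)
    then show ?case by (rule m(2))
  next
    case (inv h)
    then have "(inv h) [^] m = inv (h [^] m)" using assms(3) by (auto simp: nat_pow_inv)
    then show ?case using m(2)[OF inv] E by (simp add: subgroup.m_inv_closed)
  next
    case (eng g h)
    then have "(g \<otimes> h) [^] m = g [^] m \<otimes> h [^] m"
      using assms(3) generate_in_carrier by (simp add: nat_pow_distrib)
    then show ?case using eng E by (simp add: subgroup.m_closed)
  qed
  then show ?thesis using D m(1) assms(4) by blast
qed

text \<open>The case \<open>C = {\<one>}\<close> of the almost complement: all \<open>m\<close>-th
  powers then lie in the torsion-free subgroup \<open>D\<close>.\<close>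

lemma torsion_free_powers:
  assumes "finite S" "S \<subseteq> carrier G" "generate G S = carrier G"
  obtains m where "m > (0::nat)" "torsion_free_on G ((\<lambda>x. x [^] m) ` carrier G)"
proof -
  obtain D m where D: "subgroup D G" "torsion_free_on G D" "m > (0::nat)"
    "\<And>x. x \<in> carrier G \<Longrightarrow> x [^] m \<in> {\<one>} <#> D"
    using almost_complement[OF triv_subgroup assms] by auto
  have "{\<one>} <#> D = D"
    using subgroup.subset[OF D(1)] by (force simp: set_mult_def)
  then have "torsion_free_on G ((\<lambda>x. x [^] m) ` carrier G)"
    using D(2,4) by (auto simp: torsion_free_on_def)
  then show thesis using that D(3) by blast
qed

text \<open>\<open>C\<close> comes without generators of its own, so the comparison is made with the
  \<open>m * n\<close>-th powers of the whole group. If \<open>x [^] m = c \<otimes> d\<close> and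
  \<open>x [^] (m * n) = c [^] n \<otimes> d [^] n\<close> lies in \<open>C\<close>, then
  \<open>d [^] n \<in> C \<inter> D\<close> is trivial, and an \<open>n\<close>-th power of an
  element of \<open>C\<close> remains.\<close>

lemma virtually_contains_powers:
  assumes C: "subgroup C G" and S: "finite S" "S \<subseteq> carrier G" "generate G S = carrier G"
    and n: "n > (0::nat)"
  shows "virtually_contains G ((\<lambda>x. x [^] n) ` C) C"
proof -
  obtain D m where D: "subgroup D G" "torsion_free_on G D" "C \<inter> D = {\<one>}" "m > (0::nat)"
    "\<And>x. x \<in> carrier G \<Longrightarrow> x [^] m \<in> C <#> D"
    using almost_complement[OF C S] by auto
  let ?P = "(\<lambda>x. x [^] (m * n)) ` carrier G"
  have Cc: "C \<subseteq> carrier G" and Dc: "D \<subseteq> carrier G"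
    using C D(1) subgroup.subset by auto
  have P: "subgroup ?P G" by (rule subgroup_powers[OF subgroup_self])
  have "virtually_contains G ?P (carrier G)"
    using virtually_contains_powers_generate[OF S(1,2), of "m * n"] S(3) n D(4) by auto
  then have "virtually_contains G ?P C"
    using virtually_contains_mono[OF _ order_refl Cc] by blast
  then have v: "virtually_contains G (?P \<inter> C) C"
    using virtually_contains_Int[OF P _ C virtually_contains_refl] Cc by blast
  have "?P \<inter> C \<subseteq> (\<lambda>x. x [^] n) ` C"
  proof clarify
    fix x assume x: "x \<in> carrier G" "x [^] (m * n) \<in> C"
    obtain c d where cd: "c \<in> C" "d \<in> D" "x [^] m = c \<otimes> d"
      using D(5)[OF x(1)] by (rule set_multE)
    have cc: "c \<in> carrier G" and dc: "d \<in> carrier G" using cd Cc Dc by auto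
    have eq: "x [^] (m * n) = c [^] n \<otimes> d [^] n"
      using x(1) cd(3) cc dc by (simp add: nat_pow_distrib flip: nat_pow_pow)
    have cn: "c [^] n \<in> C" and dn: "d [^] n \<in> D"
      using cd C D(1) by (induction n) (auto simp: subgroup.one_closed subgroup.m_closed)
    have "d [^] n = inv (c [^] n) \<otimes> x [^] (m * n)" using eq cc dc by simp
    then have "d [^] n \<in> C" using cn x(2) C by (simp add: subgroup.m_closed subgroup.m_inv_closed)
    then have "d [^] n = \<one>" using dn D(3) by auto
    then show "x [^] (m * n) \<in> (\<lambda>x. x [^] n) ` C" using eq cc cd(1) by auto
  qed
  then show ?thesis using v virtually_contains_mono by blast
qed

end

subsection \<open>Normal subgroups of finite index\<close>

context group begin

section \<open>Finite generation and torsion-free normal subgroups\<close>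

lemma subgroup_comm_group_iff:
  assumes "subgroup B G"
  shows "comm_group (G\<lparr>carrier := B\<rparr>) \<longleftrightarrow> (\<forall>x\<in>B. \<forall>y\<in>B. x \<otimes> y = y \<otimes> x)"
proof
  assume "comm_group (G\<lparr>carrier := B\<rparr>)"
  then show "\<forall>x\<in>B. \<forall>y\<in>B. x \<otimes> y = y \<otimes> x"
    using comm_groupE(4) by fastforce
next
  assume "\<forall>x\<in>B. \<forall>y\<in>B. x \<otimes> y = y \<otimes> x"
  then show "comm_group (G\<lparr>carrier := B\<rparr>)"
    by (intro group.group_comm_groupI subgroup_imp_group assms) auto
qed

text \<open>Schreier's lemma. With \<open>?E\<close> generated by \<open>Y\<close>, the set
  \<open>?E <#> T\<close> is stable under right multiplication by the generators and their inverses,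
  hence by all of \<open>generate G S\<close>. Since it contains the identity, it contains
  \<open>H\<close>.\<close>

lemma finitely_generated_finite_index:
  assumes S: "finite S" "S \<subseteq> carrier G"
    and H: "subgroup H G" "H \<subseteq> generate G S" "virtually_contains G H (generate G S)"
  shows "\<exists>Y. finite Y \<and> Y \<subseteq> H \<and> generate G Y = H"
proof -
  let ?K = "generate G S"
  have K: "subgroup ?K G" using S(2) by (rule generate_is_subgroup)
  have Hc: "H \<subseteq> carrier G" and Kc: "?K \<subseteq> carrier G"
    using H(1) K by (auto dest: subgroup.subset)
  obtain T0 where T0: "finite T0" "T0 \<subseteq> carrier G" "?K \<subseteq> H <#> T0"
    using H(3) by (auto simp: virtually_contains_def)
  \<comment> \<open>Representatives are cut down to \<open>?K\<close>; adding \<one> makes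
    \<open>?E <#> T\<close> contain the identity.\<close>
  define T where "T = insert \<one> (T0 \<inter> ?K)"
  have T: "finite T" "T \<subseteq> ?K" "\<one> \<in> T"
    using T0(1) generate.one by (auto simp: T_def)
  have cover: "\<exists>h\<in>H. \<exists>t\<in>T. x = h \<otimes> t" if x: "x \<in> ?K" for x
  proof -
    obtain h t where ht: "h \<in> H" "t \<in> T0" "x = h \<otimes> t"
      using T0(3) x by (blast elim: set_multE)
    then have "t = inv h \<otimes> x" using Hc T0(2) by (simp add: subsetD)
    moreover have "inv h \<in> ?K" using ht(1) H(2) K by (auto intro: subgroup.m_inv_closed)
    ultimately have "t \<in> ?K" using x K by (simp add: subgroup.m_closed)
    then show ?thesis using ht by (auto simp: T_def)
  qed
  define S' where "S' = S \<union> (\<lambda>s. inv s) ` S"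
  \<comment> \<open>\<open>T\<close> may meet a coset more than once, so all products
    \<open>t \<otimes> s \<otimes> inv u\<close> lying in \<open>H\<close> are allowed.
    \<open>T \<inter> H\<close> is included because \<open>h = e \<otimes> t\<close> with
    \<open>h, e \<in> H\<close> only shows \<open>t \<in> H\<close>, not
    \<open>t = \<one>\<close>.\<close>
  define Y where "Y = ((\<lambda>(t, s, u). t \<otimes> s \<otimes> inv u) ` (T \<times> S' \<times> T) \<union> T) \<inter> H"
  let ?E = "generate G Y"
  have Y: "finite Y" "Y \<subseteq> H" using T(1) S(1) by (auto simp: Y_def S'_def)
  have E: "subgroup ?E G" using Y(2) Hc by (intro generate_is_subgroup) auto
  have EH: "?E \<subseteq> H" using Y(2) H(1) by (rule generate_subgroup_incl)
  have step: "y \<otimes> s \<in> ?E <#> T" if y: "y \<in> ?E <#> T" and s: "s \<in> S'" for y s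
  proof -
    obtain e t where et: "e \<in> ?E" "t \<in> T" "y = e \<otimes> t" using y by (rule set_multE)
    have sK: "s \<in> ?K" using s by (auto simp: S'_def intro: generate.incl generate.inv)
    then have "t \<otimes> s \<in> ?K" using et T(2) K by (auto intro: subgroup.m_closed)
    then obtain h u where hu: "h \<in> H" "u \<in> T" "t \<otimes> s = h \<otimes> u" using cover by blast
    have c: "e \<in> carrier G" "t \<in> carrier G" "s \<in> carrier G" "u \<in> carrier G" "h \<in> carrier G"
      using et hu sK T(2) Kc EH Hc by auto
    have h: "h = t \<otimes> s \<otimes> inv u" using hu(3) c by (simp add: m_assoc)
    then have "h \<in> Y" using hu et(2) s unfolding Y_def by (auto intro!: image_eqI[of _ _ "(t, s, u)"])
    then have "e \<otimes> h \<in> ?E" using et(1) by (simp add: generate.eng generate.incl)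
    moreover have "y \<otimes> s = (e \<otimes> h) \<otimes> u" using et(3) hu(3) c by (simp add: m_assoc)
    ultimately show ?thesis using hu(2) by (simp add: set_multI)
  qed
  have ETc: "?E <#> T \<subseteq> carrier G" using EH Hc T(2) Kc by (intro setmult_subset_G) auto
  have right_closed: "y \<otimes> x \<in> ?E <#> T" if "x \<in> ?K" "y \<in> ?E <#> T" for x y
    using that
  proof (induction arbitrary: y)
    case (eng g h)
    then have "y \<otimes> (g \<otimes> h) = (y \<otimes> g) \<otimes> h"
      using ETc Kc by (simp add: m_assoc subsetD)
    then show ?case using eng by simp
  qed (use step ETc in \<open>auto simp: S'_def\<close>)
  have "H \<subseteq> ?E"
  proof
    fix h assume h: "h \<in> H"
    have "\<one> \<otimes> h \<in> ?E <#> T"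
      using right_closed[of h "\<one> \<otimes> \<one>"] h H(2) set_multI[OF generate.one[of G] T(3), of G] by auto
    then have "h \<in> ?E <#> T" using h Hc by (simp add: subsetD)
    then obtain e t where et: "e \<in> ?E" "t \<in> T" "h = e \<otimes> t" by (rule set_multE)
    have "e \<in> carrier G" "t \<in> carrier G" using et EH Hc T(2) Kc by auto
    then have "t = inv e \<otimes> h" using et(3) by simp
    then have "t \<in> H" using et(1) EH h H(1) by (auto simp: subgroup.m_closed subgroup.m_inv_closed)
    then have "t \<in> ?E" using et(2) by (auto simp: Y_def intro: generate.incl)
    then show "h \<in> ?E" using et E by (simp add: subgroup.m_closed)
  qed
  then show ?thesis using EH Y by blast
qed

lemma virtually_contains_powers_subgroup:
  assumes B: "subgroup B G" "comm_group (G\<lparr>carrier := B\<rparr>)"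
    and S: "finite S" "S \<subseteq> B" "generate G S = B"
    and C: "subgroup C G" "C \<subseteq> B" and n: "n > (0::nat)"
  shows "virtually_contains G ((\<lambda>x. x [^] n) ` C) C"
proof -
  interpret B: comm_group "G\<lparr>carrier := B\<rparr>" by (rule B(2))
  have "virtually_contains (G\<lparr>carrier := B\<rparr>) ((\<lambda>x. x [^]\<^bsub>G\<lparr>carrier := B\<rparr>\<^esub> n) ` C) C"
    using B.virtually_contains_powers[of C S n] subgroup_incl[OF C(1) B(1) C(2)] S n
      generate_consistent[OF S(2) B(1)] by simp
  then show ?thesis
    using virtually_contains_subgroupD subgroup.subset[OF B(1)] by (simp flip: nat_pow_consistent)
qed

text \<open>For an almost complement \<open>D\<close> of \<open>C\<close>, \<open>\<phi> x\<close>
  is the \<open>C\<close>-component of \<open>x [^] m\<close>, well defined because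
  \<open>C \<inter> D\<close> is trivial. Up to a power it is a retraction of \<open>B\<close> to
  \<open>C\<close>, which is enough for the averaging.\<close>

lemma power_map_onto_subgroup:
  assumes B: "subgroup B G" "comm_group (G\<lparr>carrier := B\<rparr>)"
    and S: "finite S" "S \<subseteq> B" "generate G S = B"
    and C: "subgroup C G" "C \<subseteq> B"
  obtains \<phi> m where "m > (0::nat)" "\<And>x. x \<in> B \<Longrightarrow> \<phi> x \<in> C"
    "\<And>x y. \<lbrakk> x \<in> B; y \<in> B \<rbrakk> \<Longrightarrow> \<phi> (x \<otimes> y) = \<phi> x \<otimes> \<phi> y"
    "\<And>c. c \<in> C \<Longrightarrow> \<phi> c = c [^] m"
proof -
  interpret B: comm_group "G\<lparr>carrier := B\<rparr>" by (rule B(2))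
  obtain D m where D: "subgroup D (G\<lparr>carrier := B\<rparr>)" "C \<inter> D = {\<one>}" "m > (0::nat)"
    "\<And>x. x \<in> B \<Longrightarrow> x [^] m \<in> C <#> D"
    using B.almost_complement[of C S] subgroup_incl[OF C(1) B(1) C(2)] S
      generate_consistent[OF S(2) B(1)] by (auto simp flip: nat_pow_consistent)
  have Ds: "subgroup D G" using incl_subgroup[OF B(1) D(1)] .
  have DB: "D \<subseteq> B" using subgroup.subset[OF D(1)] by simp
  have Bc: "B \<subseteq> carrier G" using B(1) by (rule subgroup.subset)
  have comm: "x \<otimes> y = y \<otimes> x" if "x \<in> B" "y \<in> B" for x y
    using B.m_comm that by simp
  define \<phi> where "\<phi> x = (THE c. c \<in> C \<and> (\<exists>d\<in>D. x [^] m = c \<otimes> d))" for x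
  have \<phi>: "\<phi> x = c" if mem: "c \<in> C" "d \<in> D" and prod: "x [^] m = c \<otimes> d" for x c d
    unfolding \<phi>_def
  proof (rule the_equality)
    fix c' assume "c' \<in> C \<and> (\<exists>d'\<in>D. x [^] m = c' \<otimes> d')"
    then obtain d' where d': "c' \<in> C" "d' \<in> D" "c \<otimes> d = c' \<otimes> d'" using prod by auto
    have cc: "c \<in> carrier G" "d \<in> carrier G" "c' \<in> carrier G" "d' \<in> carrier G"
      using mem d' C(2) DB Bc by auto
    have "inv c' \<otimes> (c \<otimes> d) \<otimes> inv d = inv c' \<otimes> (c' \<otimes> d') \<otimes> inv d" using d'(3) by simp
    then have "inv c' \<otimes> c = d' \<otimes> inv d" using cc by (simp add: m_assoc)
    moreover have "inv c' \<otimes> c \<in> C" "d' \<otimes> inv d \<in> D"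
      using mem d' C(1) Ds by (auto simp: subgroup.m_closed subgroup.m_inv_closed)
    ultimately have "inv c' \<otimes> c = \<one>" using D(2) by auto
    then show "c' = c" using cc by (metis inv_cancel_left(2) r_one)
  qed (use that in auto)
  have ex: "\<exists>d\<in>D. \<phi> x \<in> C \<and> x [^] m = \<phi> x \<otimes> d" if x: "x \<in> B" for x
  proof -
    obtain c d where "c \<in> C" "d \<in> D" "x [^] m = c \<otimes> d" using D(4)[OF x] by (rule set_multE)
    then show ?thesis using \<phi> by auto
  qed
  show thesis
  proof (rule that[of m \<phi>])
    fix x y assume xy: "x \<in> B" "y \<in> B"
    obtain d e where d: "d \<in> D" "\<phi> x \<in> C" "x [^] m = \<phi> x \<otimes> d"
      and e: "e \<in> D" "\<phi> y \<in> C" "y [^] m = \<phi> y \<otimes> e" using ex[OF xy(1)] ex[OF xy(2)] by blast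
    have c: "x \<in> carrier G" "y \<in> carrier G" "d \<in> carrier G" "e \<in> carrier G"
      "\<phi> x \<in> carrier G" "\<phi> y \<in> carrier G" using xy d e C(2) DB Bc by auto
    have "(x \<otimes> y) [^] m = x [^] m \<otimes> y [^] m" using comm[OF xy] c by (intro pow_mult_distrib)
    also have "\<dots> = (\<phi> x \<otimes> \<phi> y) \<otimes> (d \<otimes> e)"
    proof -
      have "d \<otimes> \<phi> y = \<phi> y \<otimes> d" using comm d e C(2) DB by blast
      then have "d \<otimes> (\<phi> y \<otimes> e) = \<phi> y \<otimes> (d \<otimes> e)" using c by (simp flip: m_assoc)
      then show ?thesis using d(3) e(3) c by (simp add: m_assoc)
    qed
    finally show "\<phi> (x \<otimes> y) = \<phi> x \<otimes> \<phi> y"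
      using d e C(1) Ds by (intro \<phi>) (auto intro: subgroup.m_closed)
  next
    fix c assume c: "c \<in> C"
    then show "\<phi> c = c [^] m"
      using C Bc subgroup.one_closed[OF Ds]
      by (intro \<phi>[of _ "\<one>"]) (auto intro: subgroup_nat_pow_closed)
  qed (use D(3) ex in auto)
qed

text \<open>\<open>B\<close> may fail to be normal, but the set of \<open>e * m\<close>-th powers of
  \<open>N\<close> is invariant under conjugation, so it generates a normal subgroup
  \<open>M\<close>. The exponent \<open>e\<close> moves \<open>N\<close> into \<open>B\<close>, and
  the \<open>m\<close>-th powers of \<open>B\<close> are torsion-free. \<open>M\<close> contains the
  \<open>e * m\<close>-th powers of \<open>B\<close>, which have finite index in \<open>B\<close>,
  so \<open>M\<close> has finite index in \<open>N\<close>.\<close>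

lemma torsion_free_normal_abelian:
  assumes N: "N \<lhd> G" and S: "finite S" "S \<subseteq> carrier G" "generate G S = N"
    and B: "subgroup B G" "B \<subseteq> N" "virtually_contains G B N" "comm_group (G\<lparr>carrier := B\<rparr>)"
  obtains M Y where "M \<lhd> G" "M \<subseteq> N" "virtually_contains G M N" "comm_group (G\<lparr>carrier := M\<rparr>)"
    "torsion_free_on G M" "finite Y" "Y \<subseteq> M" "generate G Y = M"
proof -
  interpret B: comm_group "G\<lparr>carrier := B\<rparr>" by (rule B(4))
  have Ns: "subgroup N G" using N by (rule normal_imp_subgroup)
  have Nc: "N \<subseteq> carrier G" and Bc: "B \<subseteq> carrier G"
    using Ns B(1) by (auto dest: subgroup.subset)
  obtain Z where Z: "finite Z" "Z \<subseteq> B" "generate G Z = B"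
    using finitely_generated_finite_index[OF S(1,2) B(1)] S(3) B(2,3) by auto
  have Z': "generate (G\<lparr>carrier := B\<rparr>) Z = B"
    using generate_consistent[OF Z(2) B(1)] Z(3) by simp
  obtain m where m: "m > (0::nat)"
    "torsion_free_on (G\<lparr>carrier := B\<rparr>) ((\<lambda>x. x [^]\<^bsub>G\<lparr>carrier := B\<rparr>\<^esub> m) ` B)"
    using B.torsion_free_powers[of Z] Z Z' by auto
  obtain e where e: "e > (0::nat)" "\<And>x. x \<in> N \<Longrightarrow> x [^] e \<in> B"
    using power_mem_subgroup_finite_cosets[OF B(1) Ns B(3)] by blast
  let ?P = "(\<lambda>x. x [^] (e * m)) ` N"
  let ?Q = "(\<lambda>x. x [^] m) ` B"
  define M where "M = generate G ?P"
  have Pc: "?P \<subseteq> carrier G" using Nc by auto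
  have Q: "subgroup ?Q G"
    using B.subgroup_powers[OF B.subgroup_self, of m] B(1)
    by (simp add: incl_subgroup flip: nat_pow_consistent)
  have "?P \<subseteq> ?Q" using e(2) Nc by (auto simp: subsetD simp flip: nat_pow_pow)
  then have MQ: "M \<subseteq> ?Q" unfolding M_def using Q by (rule generate_subgroup_incl)
  have QB: "?Q \<subseteq> B" using B(1) by (auto intro: subgroup_nat_pow_closed)
  have MN: "M \<lhd> G"
    unfolding M_def
  proof (rule normal_generateI[OF Pc])
    fix h g assume "h \<in> ?P" and g: "g \<in> carrier G"
    then obtain x where x: "x \<in> N" "h = x [^] (e * m)" by auto
    have xc: "x \<in> carrier G" using x Nc by auto
    have "g \<otimes> x [^] n \<otimes> inv g = (g \<otimes> x \<otimes> inv g) [^] n" for n :: nat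
    proof (induction n)
      case (Suc n)
      have "g \<otimes> x [^] Suc n \<otimes> inv g = (g \<otimes> x [^] n \<otimes> inv g) \<otimes> (g \<otimes> x \<otimes> inv g)"
        using g xc by (simp add: m_assoc)
      then show ?case using Suc by simp
    qed (use g in auto)
    moreover have "g \<otimes> x \<otimes> inv g \<in> N" using N g x(1) by (simp add: normal.inv_op_closed2)
    ultimately show "g \<otimes> h \<otimes> inv g \<in> ?P" using x(2) by auto
  qed
  have Ms: "subgroup M G" using MN by (rule normal_imp_subgroup)
  have "virtually_contains G ((\<lambda>x. x [^] (e * m)) ` B) B"
    using virtually_contains_powers_subgroup[OF B(1,4) Z B(1)] e(1) m(1) by simp
  moreover have "(\<lambda>x. x [^] (e * m)) ` B \<subseteq> M"
    using B(2) unfolding M_def by (auto intro: generate.incl)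
  ultimately have "virtually_contains G M B" using virtually_contains_mono by blast
  then have vM: "virtually_contains G M N"
    using virtually_contains_trans[OF _ _ B(3)] Ms by (simp add: subgroup.subset)
  have "comm_group (G\<lparr>carrier := M\<rparr>)"
    using B(4) MQ QB subgroup_comm_group_iff[OF B(1)] subgroup_comm_group_iff[OF Ms] by blast
  moreover have "torsion_free_on G M"
    using m(2) MQ by (auto simp: torsion_free_on_def simp flip: nat_pow_consistent)
  moreover obtain Y where "finite Y" "Y \<subseteq> M" "generate G Y = M"
    using finitely_generated_finite_index[OF S(1,2) Ms] S(3) vM MQ QB B(2) by auto
  ultimately show thesis using that MN vM MQ QB B(2) by blast
qed

section \<open>Normal cores and internal semidirect products\<close>

text \<open>\<open>G\<close> permutes the finitely many right cosets of \<open>K\<close> by right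
  translation, and two elements inducing the same permutation differ by an element of
  \<open>C\<close>.\<close>

lemma normal_core:
  assumes "subgroup K G" "virtually_contains G K (carrier G)"
  defines "C \<equiv> {x \<in> carrier G. \<forall>g\<in>carrier G. g \<otimes> x \<otimes> inv g \<in> K}"
  shows "C \<lhd> G" "C \<subseteq> K" "virtually_contains G C (carrier G)"
proof -
  have Kc: "K \<subseteq> carrier G" using assms(1) by (rule subgroup.subset)
  have Cs: "subgroup C G"
  proof (rule subgroupI)
    show "C \<noteq> {}" using subgroup.one_closed[OF assms(1)] by (auto simp: C_def intro!: exI[of _ \<one>])
    fix a assume a: "a \<in> C"
    have "g \<otimes> inv a \<otimes> inv g = inv (g \<otimes> a \<otimes> inv g)" if "g \<in> carrier G" for g
      using a that by (simp add: C_def group_normalize)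
    then show "inv a \<in> C" using a assms(1) by (simp add: C_def subgroup.m_inv_closed)
    fix b assume b: "b \<in> C"
    have "g \<otimes> (a \<otimes> b) \<otimes> inv g = (g \<otimes> a \<otimes> inv g) \<otimes> (g \<otimes> b \<otimes> inv g)" if "g \<in> carrier G" for g
      using a b that by (simp add: C_def group_normalize)
    then show "a \<otimes> b \<in> C" using a b assms(1) by (simp add: C_def subgroup.m_closed)
  qed (auto simp: C_def)
  show "C \<lhd> G"
  proof (rule normal_invI[OF Cs])
    fix x h assume xh: "x \<in> carrier G" "h \<in> C"
    have "g \<otimes> (x \<otimes> h \<otimes> inv x) \<otimes> inv g = (g \<otimes> x) \<otimes> h \<otimes> inv (g \<otimes> x)" if "g \<in> carrier G" for g
      using xh that by (simp add: C_def group_normalize)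
    then show "x \<otimes> h \<otimes> inv x \<in> C" using xh by (simp add: C_def)
  qed
  show "C \<subseteq> K" by (auto simp: C_def dest: bspec[of _ _ \<one>])
  let ?R = "rcosets K"
  \<comment> \<open>Restricting the translation to \<open>?R\<close> places it in the finite set
    \<open>?R \<rightarrow>\<^sub>E ?R\<close>.\<close>
  let ?f = "\<lambda>x. \<lambda>A\<in>?R. A #> x"
  show "virtually_contains G C (carrier G)"
  proof (rule virtually_containsI[OF order_refl])
    have "?R = (\<lambda>x. K #> x) ` carrier G" by (auto simp: RCOSETS_def)
    then have "finite ?R" using virtually_contains_finite_cosets[OF assms(1,2)] by simp
    then have "finite (?R \<rightarrow>\<^sub>E ?R)" by (intro finite_PiE)
    moreover have "?f ` carrier G \<subseteq> ?R \<rightarrow>\<^sub>E ?R"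
    proof (rule image_subsetI)
      fix x assume x: "x \<in> carrier G"
      have "A #> x \<in> ?R" if "A \<in> ?R" for A
      proof -
        obtain g where "g \<in> carrier G" "A = K #> g" using \<open>A \<in> ?R\<close> by (auto simp: RCOSETS_def)
        then show ?thesis using x Kc rcosetsI[of K "g \<otimes> x"] by (simp add: coset_mult_assoc)
      qed
      then show "?f x \<in> ?R \<rightarrow>\<^sub>E ?R" by auto
    qed
    ultimately show "finite (?f ` carrier G)" using finite_subset by blast
    fix x y assume xy: "x \<in> carrier G" "y \<in> carrier G" "?f x = ?f y"
    have "g \<otimes> (x \<otimes> inv y) \<otimes> inv g \<in> K" if g: "g \<in> carrier G" for g
    proof -
      have "K #> g \<in> ?R" using g Kc by (intro rcosetsI)
      then have "(K #> g) #> x = (K #> g) #> y" using fun_cong[OF xy(3), of "K #> g"] by simp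
      then have "K #> (g \<otimes> x) = K #> (g \<otimes> y)" using g xy Kc by (simp add: coset_mult_assoc)
      then have "(g \<otimes> x) \<otimes> inv (g \<otimes> y) \<in> K" using r_coset_eqD[OF assms(1)] g xy by simp
      then show ?thesis using g xy by (simp add: group_normalize)
    qed
    then show "x \<otimes> inv y \<in> C" using xy by (simp add: C_def)
  qed
qed

lemma subgroup_semidirect:
  assumes H: "subgroup H G" and F: "subgroup F G"
    and HF: "\<And>h f. \<lbrakk> h \<in> H; f \<in> F \<rbrakk> \<Longrightarrow> h \<otimes> f \<otimes> inv h \<in> F"
  shows "subgroup (H <#> F) G"
proof (rule subgroupI)
  have c: "H \<subseteq> carrier G" "F \<subseteq> carrier G" using H F by (auto dest: subgroup.subset)
  then show "H <#> F \<subseteq> carrier G" by (rule setmult_subset_G)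
  show "H <#> F \<noteq> {}"
    using set_multI[OF subgroup.one_closed[OF H] subgroup.one_closed[OF F], of G] by auto
  fix a assume "a \<in> H <#> F"
  then obtain h f where a: "h \<in> H" "f \<in> F" "a = h \<otimes> f" by (rule set_multE)
  have "inv a = inv h \<otimes> (h \<otimes> inv f \<otimes> inv h)"
    using a c by (simp add: group_normalize subsetD)
  then show "inv a \<in> H <#> F"
    using a H F HF by (simp add: set_multI subgroup.m_inv_closed)
  fix b assume "b \<in> H <#> F"
  then obtain k e where b: "k \<in> H" "e \<in> F" "b = k \<otimes> e" by (rule set_multE)
  have "a \<otimes> b = (h \<otimes> k) \<otimes> ((inv k \<otimes> f \<otimes> inv (inv k)) \<otimes> e)"
    using a b c by (simp add: group_normalize subsetD)
  moreover have "inv k \<otimes> f \<otimes> inv (inv k) \<in> F"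
    using HF[of "inv k" f] a(2) b(1) H by (simp only: subgroup.m_inv_closed)
  ultimately show "a \<otimes> b \<in> H <#> F"
    using a(1) b H F by (simp only: set_multI subgroup.m_closed)
qed

text \<open>\<open>H <#> F\<close> is an internal semidirect product, so every element has a unique
  \<open>H\<close>-component; the retraction takes this component and has kernel
  \<open>F\<close>.\<close>

lemma virtual_retractI:
  assumes H: "subgroup H G" and F: "subgroup F G"
    and HF: "\<And>h f. \<lbrakk> h \<in> H; f \<in> F \<rbrakk> \<Longrightarrow> h \<otimes> f \<otimes> inv h \<in> F"
    and triv: "H \<inter> F = {\<one>}" and fin: "virtually_contains G (H <#> F) (carrier G)"
  shows "virtual_retract H G"
proof -
  let ?Z = "H <#> F"
  have c: "H \<subseteq> carrier G" "F \<subseteq> carrier G" using H F by (auto dest: subgroup.subset)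
  define \<rho> where "\<rho> z = (THE h. h \<in> H \<and> (\<exists>f\<in>F. z = h \<otimes> f))" for z
  have \<rho>: "\<rho> (h \<otimes> f) = h" if "h \<in> H" "f \<in> F" for h f
    unfolding \<rho>_def
  proof (rule the_equality)
    fix k assume "k \<in> H \<and> (\<exists>e\<in>F. h \<otimes> f = k \<otimes> e)"
    then obtain e where e: "k \<in> H" "e \<in> F" "h \<otimes> f = k \<otimes> e" by blast
    have cc: "h \<in> carrier G" "k \<in> carrier G" "e \<in> carrier G" "f \<in> carrier G"
      using that e c by auto
    have "h = k \<otimes> (e \<otimes> inv f)" using e(3) cc by (simp flip: m_assoc) (simp add: m_assoc flip: e(3))
    then have "inv k \<otimes> h = e \<otimes> inv f" using cc by simp
    moreover have "inv k \<otimes> h \<in> H" "e \<otimes> inv f \<in> F"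
      using that e H F by (auto simp: subgroup.m_closed subgroup.m_inv_closed)
    ultimately have "inv k \<otimes> h \<in> H \<inter> F" by auto
    then have "inv k \<otimes> h = \<one>" using triv by auto
    then show "k = h" using cc by (metis inv_cancel_left(2) r_one)
  qed (use that in auto)
  have "\<rho> \<in> hom (G\<lparr>carrier := ?Z\<rparr>) (G\<lparr>carrier := H\<rparr>)"
  proof (rule homI)
    fix x y assume "x \<in> carrier (G\<lparr>carrier := ?Z\<rparr>)" "y \<in> carrier (G\<lparr>carrier := ?Z\<rparr>)"
    then obtain h f k e where x: "h \<in> H" "f \<in> F" "x = h \<otimes> f" and y: "k \<in> H" "e \<in> F" "y = k \<otimes> e"
      by (auto elim!: set_multE)
    have "x \<otimes> y = (h \<otimes> k) \<otimes> ((inv k \<otimes> f \<otimes> inv (inv k)) \<otimes> e)"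
      using x y c by (simp add: group_normalize subsetD)
    moreover have "inv k \<otimes> f \<otimes> inv (inv k) \<in> F"
      using HF[of "inv k" f] x(2) y(1) H by (simp only: subgroup.m_inv_closed)
    ultimately have "\<rho> (x \<otimes> y) = h \<otimes> k"
      using x(1) y \<rho> H F by (simp only: subgroup.m_closed)
    then show "\<rho> (x \<otimes>\<^bsub>G\<lparr>carrier := ?Z\<rparr>\<^esub> y) = \<rho> x \<otimes>\<^bsub>G\<lparr>carrier := H\<rparr>\<^esub> \<rho> y"
      using x y \<rho> by simp
  qed (auto elim!: set_multE simp: \<rho>)
  moreover have "\<rho> h = h" "h \<in> ?Z" if "h \<in> H" for h
    using \<rho>[OF that subgroup.one_closed[OF F]] set_multI[OF that subgroup.one_closed[OF F], of G]
      that c by (auto simp: subsetD)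
  ultimately show ?thesis
    unfolding virtual_retract_def finite_index_subgroup_iff
    using H subgroup_semidirect[OF H F HF] fin by (intro conjI exI[of _ ?Z]) auto
qed

end

subsection \<open>Equivariant complements\<close>

context group begin

text \<open>The conjugates of \<open>\<phi>\<close> under \<open>H\<close> form a finite set permuted by \<open>H\<close>, so their product
  \<open>\<psi> : W \<rightarrow> C\<close> is an \<open>H\<close>-equivariant homomorphism that is a power map on \<open>C\<close>;
  its kernel is the required subgroup.\<close>

lemma equivariant_complement:
  assumes H: "subgroup H G" and W: "subgroup W G"
    and HW: "\<And>h x. \<lbrakk> h \<in> H; x \<in> W \<rbrakk> \<Longrightarrow> h \<otimes> x \<otimes> inv h \<in> W"
    and C: "subgroup C G" "C \<subseteq> W"
    and HC: "\<And>h c. \<lbrakk> h \<in> H; c \<in> C \<rbrakk> \<Longrightarrow> h \<otimes> c \<otimes> inv h \<in> C"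
    and comm: "comm_group (G\<lparr>carrier := C\<rparr>)" and tf: "torsion_free_on G C"
    and pow: "\<And>n. n > (0::nat) \<Longrightarrow> virtually_contains G ((\<lambda>x. x [^] n) ` C) C"
    and \<phi>C: "\<And>x. x \<in> W \<Longrightarrow> \<phi> x \<in> C"
    and \<phi>_mult: "\<And>x y. \<lbrakk> x \<in> W; y \<in> W \<rbrakk> \<Longrightarrow> \<phi> (x \<otimes> y) = \<phi> x \<otimes> \<phi> y"
    and \<phi>_pow: "\<And>c. c \<in> C \<Longrightarrow> \<phi> c = c [^] m" and m: "m > (0::nat)"
    and U: "subgroup U G" "U \<subseteq> H" "virtually_contains G U H"
    and \<phi>_U: "\<And>u x. \<lbrakk> u \<in> U; x \<in> W \<rbrakk> \<Longrightarrow> \<phi> (u \<otimes> x \<otimes> inv u) = u \<otimes> \<phi> x \<otimes> inv u"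
  obtains D where "subgroup D G" "D \<subseteq> W" "C \<inter> D = {\<one>}" "virtually_contains G (C <#> D) W"
    "\<And>h d. \<lbrakk> h \<in> H; d \<in> D \<rbrakk> \<Longrightarrow> h \<otimes> d \<otimes> inv h \<in> D"
proof -
  interpret C: comm_group "G\<lparr>carrier := C\<rparr>" by (rule comm)
  have Hc: "H \<subseteq> carrier G" and Wc: "W \<subseteq> carrier G" and Cc: "C \<subseteq> carrier G"
    using H W C by (auto dest: subgroup.subset)
  have HW': "inv h \<otimes> x \<otimes> h \<in> W" if "h \<in> H" "x \<in> W" for h x
    using HW[of "inv h" x] that H Hc by (simp add: subgroup.m_inv_closed subsetD)
  have HC': "inv h \<otimes> c \<otimes> h \<in> C" if "h \<in> H" "c \<in> C" for h c
    using HC[of "inv h" c] that H Hc by (simp add: subgroup.m_inv_closed subsetD)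
  \<comment> \<open>The conjugation action on functions. Restriction to \<open>W\<close> makes two
    conjugates equal as soon as they agree on \<open>W\<close>.\<close>
  define act where "act h f = (\<lambda>x\<in>W. h \<otimes> f (inv h \<otimes> x \<otimes> h) \<otimes> inv h)" for h f
  define \<Phi> where "\<Phi> = (\<lambda>h. act h \<phi>) ` H"
  have act_mem: "act h \<phi> \<in> \<Phi>" if "h \<in> H" for h using that by (simp add: \<Phi>_def)
  have act_act: "act g (act h \<phi>) = act (g \<otimes> h) \<phi>" if "g \<in> H" "h \<in> H" for g h
  proof
    fix x
    show "act g (act h \<phi>) x = act (g \<otimes> h) \<phi> x"
    proof (cases "x \<in> W")
      case True
      have c: "g \<in> carrier G" "h \<in> carrier G" "x \<in> carrier G" using that True Hc Wc by auto
      have e: "inv h \<otimes> (inv g \<otimes> x \<otimes> g) \<otimes> h = inv (g \<otimes> h) \<otimes> x \<otimes> (g \<otimes> h)"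
        using c by (simp add: group_normalize)
      have "inv (g \<otimes> h) \<otimes> x \<otimes> (g \<otimes> h) \<in> W"
        using HW'[OF that(2) HW'[OF that(1) True]] e by simp
      then have "\<phi> (inv (g \<otimes> h) \<otimes> x \<otimes> (g \<otimes> h)) \<in> carrier G" using \<phi>C Cc by blast
      then show ?thesis
        using True HW'[OF that(1) True] c unfolding act_def by (simp add: e) (simp add: group_normalize)
    qed (simp add: act_def)
  qed
  have fin: "finite \<Phi>"
  proof -
    obtain T where T: "finite T" "T \<subseteq> carrier G" "H \<subseteq> U <#> T"
      using U(3) by (auto simp: virtually_contains_def)
    \<comment> \<open>Writing \<open>inv h = u \<otimes> t\<close> with \<open>u \<in> U\<close>,
      the \<open>U\<close>-equivariance of \<open>\<phi>\<close> removes \<open>u\<close>, so the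
      conjugate depends on the representative \<open>t\<close> only.\<close>
    have "\<Phi> \<subseteq> (\<lambda>t. act (inv t) \<phi>) ` (T \<inter> H)"
    proof
      fix f assume "f \<in> \<Phi>"
      then obtain h where h: "h \<in> H" "f = act h \<phi>" by (auto simp: \<Phi>_def)
      have "inv h \<in> U <#> T" using T(3) subgroup.m_inv_closed[OF H h(1)] by blast
      then obtain u t where ut: "u \<in> U" "t \<in> T" "inv h = u \<otimes> t" by (rule set_multE)
      have c: "u \<in> carrier G" "t \<in> carrier G" "h \<in> carrier G"
        using ut T(2) U(2) Hc h by auto
      have "t = inv u \<otimes> inv h" using ut(3) c by simp
      then have tH: "t \<in> H" using ut(1) h(1) U(2) H by (auto simp: subgroup.m_closed subgroup.m_inv_closed)
      have h_eq: "h = inv t \<otimes> inv u" using ut(3) c by (metis inv_inv inv_mult_group)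
      have "act h \<phi> x = act (inv t) \<phi> x" for x
      proof (cases "x \<in> W")
        case True
        have xc: "x \<in> carrier G" using True Wc by auto
        have y: "t \<otimes> x \<otimes> inv t \<in> W" using HW[OF tH True] .
        have "inv h \<otimes> x \<otimes> h = u \<otimes> (t \<otimes> x \<otimes> inv t) \<otimes> inv u"
          unfolding h_eq using c xc by (simp add: group_normalize)
        then have "\<phi> (inv h \<otimes> x \<otimes> h) = u \<otimes> \<phi> (t \<otimes> x \<otimes> inv t) \<otimes> inv u"
          using \<phi>_U[OF ut(1) y] by simp
        moreover have "\<phi> (t \<otimes> x \<otimes> inv t) \<in> carrier G" using \<phi>C[OF y] Cc by auto
        ultimately show ?thesis
          using True c unfolding act_def by simp (simp add: h_eq group_normalize)
      qed (simp add: act_def)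
      then show "f \<in> (\<lambda>t. act (inv t) \<phi>) ` (T \<inter> H)" using h(2) ut(2) tH by auto
    qed
    then show ?thesis using T(1) finite_subset by blast
  qed
  have \<Phi>C: "f x \<in> C" if f: "f \<in> \<Phi>" and x: "x \<in> W" for f x
  proof -
    obtain h where h: "h \<in> H" "f = act h \<phi>" using f by (auto simp: \<Phi>_def)
    show ?thesis using HC[OF h(1) \<phi>C[OF HW'[OF h(1) x]]] h(2) x by (simp add: act_def)
  qed
  have \<Phi>_mult: "f (x \<otimes> y) = f x \<otimes> f y" if f: "f \<in> \<Phi>" and xy: "x \<in> W" "y \<in> W" for f x y
  proof -
    obtain h where h: "h \<in> H" "f = act h \<phi>" using f by (auto simp: \<Phi>_def)
    have c: "h \<in> carrier G" "x \<in> carrier G" "y \<in> carrier G" using h xy Hc Wc by auto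
    have "inv h \<otimes> (x \<otimes> y) \<otimes> h = (inv h \<otimes> x \<otimes> h) \<otimes> (inv h \<otimes> y \<otimes> h)"
      using c by (simp add: group_normalize)
    then have "\<phi> (inv h \<otimes> (x \<otimes> y) \<otimes> h) = \<phi> (inv h \<otimes> x \<otimes> h) \<otimes> \<phi> (inv h \<otimes> y \<otimes> h)"
      using \<phi>_mult HW' h(1) xy by simp
    moreover have "\<phi> (inv h \<otimes> x \<otimes> h) \<in> carrier G" "\<phi> (inv h \<otimes> y \<otimes> h) \<in> carrier G"
      using \<phi>C HW' h(1) xy Cc by blast+
    ultimately show ?thesis
      using xy W c h(2) unfolding act_def by (simp add: subgroup.m_closed) (simp add: group_normalize)
  qed
  have \<Phi>_pow: "f c = c [^] m" if f: "f \<in> \<Phi>" and c: "c \<in> C" for f c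
  proof -
    obtain h where h: "h \<in> H" "f = act h \<phi>" using f by (auto simp: \<Phi>_def)
    have cc: "h \<in> carrier G" "c \<in> carrier G" using h c Hc Cc by auto
    \<comment> \<open>Powers commute with conjugation, so every conjugate of \<open>\<phi>\<close>
      is the same power map on \<open>C\<close>.\<close>
    have "h \<otimes> (inv h \<otimes> c \<otimes> h) [^] n \<otimes> inv h = c [^] n" for n :: nat
    proof (induction n)
      case (Suc n)
      have "h \<otimes> (inv h \<otimes> c \<otimes> h) [^] Suc n \<otimes> inv h
          = (h \<otimes> (inv h \<otimes> c \<otimes> h) [^] n \<otimes> inv h) \<otimes> c"
        using cc by (simp add: group_normalize)
      then show ?case using Suc by simp
    qed (use cc in auto)
    then show ?thesis
      using \<phi>_pow[OF HC'[OF h(1) c]] h(2) c C(2) by (auto simp: act_def)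
  qed
  have act_\<Phi>: "act h ` \<Phi> = \<Phi>" if h: "h \<in> H" for h
  proof (intro equalityI subsetI)
    fix f assume "f \<in> act h ` \<Phi>"
    then show "f \<in> \<Phi>" using h act_act subgroup.m_closed[OF H] by (auto simp: \<Phi>_def)
  next
    fix f assume "f \<in> \<Phi>"
    then obtain g where g: "g \<in> H" "f = act g \<phi>" by (auto simp: \<Phi>_def)
    have k: "inv h \<otimes> g \<in> H" using h g H by (simp add: subgroup.m_closed subgroup.m_inv_closed)
    have "f = act h (act (inv h \<otimes> g) \<phi>)"
      using act_act[OF h k] h g Hc by (simp add: subsetD)
    then show "f \<in> act h ` \<Phi>" using act_mem[OF k] by blast
  qed
  have act_inj: "inj_on (act h) \<Phi>" if h: "h \<in> H" for h
    using fin act_\<Phi>[OF h] by (intro eq_card_imp_inj_on) auto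
  \<comment> \<open>The product lives in the abelian group \<open>C\<close>, so permuting
    \<open>\<Phi>\<close> by \<open>act h\<close> does not change it; this gives the
    equivariance.\<close>
  define \<psi> where "\<psi> x = finprod (G\<lparr>carrier := C\<rparr>) (\<lambda>f. f x) \<Phi>" for x
  have \<psi>C: "\<psi> x \<in> C" if "x \<in> W" for x
    using C.finprod_closed[of "\<lambda>f. f x" \<Phi>] \<Phi>C that by (auto simp: \<psi>_def)
  have \<psi>_mult: "\<psi> (x \<otimes> y) = \<psi> x \<otimes> \<psi> y" if "x \<in> W" "y \<in> W" for x y
  proof -
    have "\<psi> (x \<otimes> y) = finprod (G\<lparr>carrier := C\<rparr>) (\<lambda>f. f x \<otimes> f y) \<Phi>"
      unfolding \<psi>_def using \<Phi>_mult \<Phi>C that C(1) subgroup.m_closed[OF W that]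
      by (intro C.finprod_cong') (auto simp: subgroup.m_closed)
    also have "\<dots> = \<psi> x \<otimes> \<psi> y"
      using C.finprod_multf[of "\<lambda>f. f x" \<Phi> "\<lambda>f. f y"] \<Phi>C that by (auto simp: \<psi>_def)
    finally show ?thesis .
  qed
  \<comment> \<open>Each of the \<open>card \<Phi>\<close> factors of \<open>\<psi> c\<close> is
    \<open>c [^] m\<close>.\<close>
  define n where "n = m * card \<Phi>"
  have "\<Phi> \<noteq> {}" using subgroup.one_closed[OF H] by (auto simp: \<Phi>_def)
  then have n: "n > 0" using m fin by (simp add: n_def card_gt_0_iff)
  have \<psi>_pow: "\<psi> c = c [^] n" if c: "c \<in> C" for c
  proof -
    have cm: "c [^] m \<in> C" using C(1) c by (rule subgroup_nat_pow_closed)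
    have "\<psi> c = finprod (G\<lparr>carrier := C\<rparr>) (\<lambda>f. c [^] m) \<Phi>"
      unfolding \<psi>_def using \<Phi>_pow c cm by (intro C.finprod_cong') auto
    also have "\<dots> = (c [^] m) [^] card \<Phi>"
      using C.finprod_const[of "c [^] m" \<Phi>] cm by (simp flip: nat_pow_consistent)
    also have "\<dots> = c [^] n" using c Cc by (simp add: n_def nat_pow_pow subsetD)
    finally show ?thesis .
  qed
  have \<psi>_equiv: "\<psi> (h \<otimes> x \<otimes> inv h) = h \<otimes> \<psi> x \<otimes> inv h" if h: "h \<in> H" and x: "x \<in> W" for h x
  proof -
    let ?y = "h \<otimes> x \<otimes> inv h"
    have hc: "h \<in> carrier G" and xc: "x \<in> carrier G" using h x Hc Wc by auto
    have y: "?y \<in> W" using HW[OF h x] .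
    have "inv h \<otimes> ?y \<otimes> h = x" using hc xc by (simp add: group_normalize)
    then have act_y: "act h f ?y = h \<otimes> f x \<otimes> inv h" for f
      using y by (simp add: act_def)
    have "\<psi> ?y = finprod (G\<lparr>carrier := C\<rparr>) (\<lambda>f. f ?y) (act h ` \<Phi>)"
      using act_\<Phi>[OF h] by (simp add: \<psi>_def)
    also have "\<dots> = finprod (G\<lparr>carrier := C\<rparr>) (\<lambda>f. act h f ?y) \<Phi>"
      using act_\<Phi>[OF h] act_inj[OF h] \<Phi>C y by (intro C.finprod_reindex) auto
    also have "\<dots> = finprod (G\<lparr>carrier := C\<rparr>) (\<lambda>f. h \<otimes> f x \<otimes> inv h) \<Phi>"
      by (simp add: act_y)
    also have "\<dots> = h \<otimes> \<psi> x \<otimes> inv h"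
    proof -
      \<comment> \<open>Conjugation by \<open>h\<close> is multiplicative, so it passes through the
        product factor by factor.\<close>
      have "finprod (G\<lparr>carrier := C\<rparr>) (\<lambda>f. h \<otimes> f x \<otimes> inv h) F
          = h \<otimes> finprod (G\<lparr>carrier := C\<rparr>) (\<lambda>f. f x) F \<otimes> inv h" if "F \<subseteq> \<Phi>" for F
        using finite_subset[OF that fin] that
      proof (induction F)
        case empty
        then show ?case using hc by simp
      next
        case (insert f F)
        let ?p = "finprod (G\<lparr>carrier := C\<rparr>) (\<lambda>f. f x) F"
        have fC: "f x \<in> C" using insert.prems \<Phi>C x by auto
        have pC: "?p \<in> C"
          using C.finprod_closed[of "\<lambda>f. f x" F] insert.prems \<Phi>C x by auto
        have "finprod (G\<lparr>carrier := C\<rparr>) (\<lambda>f. h \<otimes> f x \<otimes> inv h) (insert f F)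
            = (h \<otimes> f x \<otimes> inv h) \<otimes> (h \<otimes> ?p \<otimes> inv h)"
          using insert HC[OF h] \<Phi>C[OF _ x]
            C.finprod_insert[of F f "\<lambda>f. h \<otimes> f x \<otimes> inv h"] by (simp add: Pi_def subset_iff)
        also have "\<dots> = h \<otimes> (f x \<otimes> ?p) \<otimes> inv h"
          using fC pC Cc hc by (simp add: group_normalize subsetD)
        also have "f x \<otimes> ?p = finprod (G\<lparr>carrier := C\<rparr>) (\<lambda>f. f x) (insert f F)"
          using insert \<Phi>C[OF _ x] C.finprod_insert[of F f "\<lambda>f. f x"] by (simp add: Pi_def subset_iff)
        finally show ?case .
      qed
      then show ?thesis by (simp add: \<psi>_def)
    qed
    finally show ?thesis .
  qed
  define D where "D = {x \<in> W. \<psi> x = \<one>}"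
  have \<psi>_one: "\<psi> \<one> = \<one>" using \<psi>_pow[OF subgroup.one_closed[OF C(1)]] by simp
  have \<psi>_inv: "\<psi> (inv x) = inv (\<psi> x)" if x: "x \<in> W" for x
  proof -
    have "\<psi> (inv x) \<otimes> \<psi> x = \<one>"
      using \<psi>_mult[of "inv x" x] x W Wc \<psi>_one by (simp add: subgroup.m_inv_closed subsetD)
    moreover have "\<psi> (inv x) \<in> carrier G" "\<psi> x \<in> carrier G"
      using \<psi>C x subgroup.m_inv_closed[OF W x] Cc by auto
    ultimately show ?thesis by (simp add: inv_equality)
  qed
  have Ds: "subgroup D G"
  proof (rule subgroupI)
    show "D \<subseteq> carrier G" using Wc by (auto simp: D_def)
    show "D \<noteq> {}" using \<psi>_one subgroup.one_closed[OF W] by (auto simp: D_def)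
  qed (use \<psi>_mult \<psi>_inv W in \<open>auto simp: D_def subgroup.m_closed subgroup.m_inv_closed\<close>)
  \<comment> \<open>On the torsion-free \<open>C\<close>, \<open>\<psi>\<close> is the
    \<open>n\<close>-th power map with \<open>n > 0\<close>, whose kernel is trivial.\<close>
  have "C \<inter> D = {\<one>}"
    using tf n \<psi>_pow subgroup.one_closed[OF C(1)] subgroup.one_closed[OF Ds]
    by (auto simp: torsion_free_on_def D_def)
  moreover have "virtually_contains G (C <#> D) W"
  proof (rule virtually_containsI[OF Wc])
    \<comment> \<open>The invariant is \<open>\<psi> x\<close> modulo \<open>n\<close>-th powers of
      \<open>C\<close>. If \<open>\<psi> (x \<otimes> inv y) = c [^] n = \<psi> c\<close>, then
      \<open>inv c \<otimes> (x \<otimes> inv y)\<close> lies in the kernel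
      \<open>D\<close>.\<close>
    let ?P = "(\<lambda>x. x [^] n) ` C"
    have P: "subgroup ?P G"
      using C.subgroup_powers[OF C.subgroup_self, of n] C(1)
      by (simp add: incl_subgroup flip: nat_pow_consistent)
    have "(\<lambda>x. ?P #> \<psi> x) ` W \<subseteq> (\<lambda>x. ?P #> x) ` C" using \<psi>C by auto
    then show "finite ((\<lambda>x. ?P #> \<psi> x) ` W)"
      using virtually_contains_finite_cosets[OF P pow[OF n]] finite_subset by blast
    fix x y assume xy: "x \<in> W" "y \<in> W" "?P #> \<psi> x = ?P #> \<psi> y"
    have "\<psi> x \<otimes> inv (\<psi> y) \<in> ?P"
      using r_coset_eqD[OF P _ _ xy(3)] \<psi>C[OF xy(1)] \<psi>C[OF xy(2)] Cc by auto
    then obtain c where c: "c \<in> C" "\<psi> x \<otimes> inv (\<psi> y) = c [^] n" by auto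
    have z: "x \<otimes> inv y \<in> W" using xy W by (simp add: subgroup.m_closed subgroup.m_inv_closed)
    have "\<psi> (x \<otimes> inv y) = \<psi> c"
      using \<psi>_mult[of x "inv y"] \<psi>_inv xy W c \<psi>_pow by (simp add: subgroup.m_inv_closed)
    moreover have cW: "c \<in> W" "\<psi> c \<in> carrier G" using c(1) C(2) \<psi>C[of c] Cc by auto
    ultimately have "\<psi> (inv c \<otimes> (x \<otimes> inv y)) = \<one>"
      using \<psi>_mult[of "inv c" "x \<otimes> inv y"] \<psi>_inv[of c] z W by (simp add: subgroup.m_inv_closed)
    then have d: "inv c \<otimes> (x \<otimes> inv y) \<in> D"
      using z c(1) C(2) W by (auto simp: D_def subgroup.m_closed subgroup.m_inv_closed)
    have "x \<otimes> inv y = c \<otimes> (inv c \<otimes> (x \<otimes> inv y))"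
      using c(1) Cc z Wc by (simp add: subsetD)
    then show "x \<otimes> inv y \<in> C <#> D" using set_multI[OF c(1) d, of G] by simp
  qed
  moreover have "h \<otimes> d \<otimes> inv h \<in> D" if "h \<in> H" "d \<in> D" for h d
    using that \<psi>_equiv[of h d] HW Hc by (auto simp: D_def)
  moreover have "D \<subseteq> W" by (auto simp: D_def)
  ultimately show thesis using that[of D] Ds by blast
qed

end

subsection \<open>Quotients\<close>

text \<open>Every element is the product of a finite word over \<open>S\<close> and its inverses,
  and a countable alphabet has countably many words.\<close>

lemma (in group) countable_generate:
  assumes "S \<subseteq> carrier G" "countable S"
  shows "countable (generate G S)"
proof -
  define Z where "Z = S \<union> (\<lambda>s. inv s) ` S"
  let ?W = "(\<lambda>xs. foldr (\<otimes>) xs \<one>) ` lists Z"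
  have Zc: "Z \<subseteq> carrier G" using assms(1) by (auto simp: Z_def)
  have closed: "foldr (\<otimes>) xs \<one> \<in> carrier G" if "xs \<in> lists Z" for xs
    using that Zc by (induction xs) auto
  have append: "foldr (\<otimes>) (xs @ ys) \<one> = foldr (\<otimes>) xs \<one> \<otimes> foldr (\<otimes>) ys \<one>"
    if "xs \<in> lists Z" "ys \<in> lists Z" for xs ys
    using that(1)
  proof induction
    case Nil
    then show ?case using closed[OF that(2)] by simp
  next
    case (Cons x xs)
    then show ?case using closed Zc that(2) by (simp add: m_assoc subsetD flip: foldr_append)
  qed
  have single: "z \<in> ?W" if "z \<in> Z" for z
    using that Zc by (intro image_eqI[of _ _ "[z]"]) auto
  have "x \<in> ?W" if "x \<in> generate G S" for x
    using that
  proof induction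
    case one
    then show ?case by (intro image_eqI[of _ _ "[]"]) auto
  next
    case (eng g h)
    then obtain xs ys where "xs \<in> lists Z" "ys \<in> lists Z"
      "g = foldr (\<otimes>) xs \<one>" "h = foldr (\<otimes>) ys \<one>" by auto
    then show ?case using append by (intro image_eqI[of _ _ "xs @ ys"]) auto
  next
    case (incl h)
    show ?case by (rule single) (simp add: Z_def incl)
  next
    case (inv h)
    show ?case by (rule single) (simp add: Z_def inv)
  qed
  then have "generate G S \<subseteq> ?W" by (rule subsetI)
  moreover have "countable ?W" using assms(2) by (simp add: Z_def)
  ultimately show ?thesis by (rule countable_subset)
qed

lemma fin_gen_group_countable: "fin_gen_group G \<Longrightarrow> countable (carrier G)"
  unfolding fin_gen_group_def by (metis countable_finite group.countable_generate)

lemma (in group) nat_isomorphic_copy: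
  assumes "countable (carrier G)"
  obtains A :: "nat monoid" and f where "group A" "f \<in> iso G A"
proof -
  let ?f = "to_nat_on (carrier G)"
  let ?g = "inv_into (carrier G) ?f"
  define A :: "nat monoid" where
    "A = \<lparr>carrier = ?f ` carrier G, monoid.mult = \<lambda>x y. ?f (?g x \<otimes> ?g y), one = ?f \<one>\<rparr>"
  have inj: "inj_on ?f (carrier G)" using assms by (rule inj_on_to_nat_on)
  then have "?f \<in> hom G A" by (auto intro!: homI simp: A_def)
  then have "?f \<in> iso G A" using inj by (auto simp: iso_def bij_betw_def A_def)
  moreover have "group A"
    using iso_imp_img_group[OF \<open>?f \<in> iso G A\<close>] by (simp add: A_def)
  ultimately show thesis using that by blast
qed

section \<open>Images and preimages under homomorphisms\<close>

lemma (in group_hom) image_fin_gen_virtually_abelian: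
  assumes surj: "h ` carrier G = carrier H"
    and M: "subgroup M G" "comm_group (G\<lparr>carrier := M\<rparr>)"
    and Y: "finite Y" "Y \<subseteq> M" "generate G Y = M"
    and L: "L \<subseteq> kernel G H h" and fin: "virtually_contains G (M <#> L) (carrier G)"
  shows "fin_gen_group H" "virtually_abelian H"
proof -
  have Mc: "M \<subseteq> carrier G" using M(1) by (rule subgroup.subset)
  have hM: "subgroup (h ` M) H" using M(1) by (rule subgroup_img_is_subgroup)
  obtain T where T: "finite T" "T \<subseteq> carrier G" "carrier G \<subseteq> M <#> L <#> T"
    using fin by (auto simp: virtually_contains_def)
  have cover: "\<exists>m\<in>M. \<exists>t\<in>T. x = h m \<otimes>\<^bsub>H\<^esub> h t" if x: "x \<in> carrier H" for x
  proof -
    obtain g where g: "g \<in> carrier G" "x = h g" using x surj by auto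
    obtain z t where z: "z \<in> M <#> L" "t \<in> T" "g = z \<otimes> t"
      using T(3) g(1) by (blast elim: set_multE)
    obtain m l where ml: "m \<in> M" "l \<in> L" "z = m \<otimes> l" using z(1) by (rule set_multE)
    have c: "m \<in> carrier G" "l \<in> carrier G" "t \<in> carrier G" "h l = \<one>\<^bsub>H\<^esub>"
      using ml z Mc T(2) L by (auto simp: kernel_def)
    then have "x = h m \<otimes>\<^bsub>H\<^esub> h t" using g(2) z(3) ml(3) by simp
    then show ?thesis using ml(1) z(2) by blast
  qed
  let ?S = "h ` (Y \<union> T)"
  have Sc: "?S \<subseteq> carrier H" using Y(2) Mc T(2) by auto
  have "h ` M = generate H (h ` Y)" using generate_img[of Y] Y Mc by auto
  then have hM_S: "h ` M \<subseteq> generate H ?S" using H.mono_generate[of "h ` Y" ?S] by auto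
  have "carrier H \<subseteq> generate H ?S"
  proof
    fix x assume "x \<in> carrier H"
    then obtain m t where mt: "m \<in> M" "t \<in> T" "x = h m \<otimes>\<^bsub>H\<^esub> h t" using cover by blast
    then have "h m \<in> generate H ?S" "h t \<in> generate H ?S"
      using hM_S by (auto intro: generate.incl)
    then show "x \<in> generate H ?S" unfolding mt(3) by (rule generate.eng)
  qed
  then have "generate H ?S = carrier H" using H.generate_incl[OF Sc] by blast
  moreover have "finite ?S" using Y(1) T(1) by simp
  ultimately show "fin_gen_group H" using Sc unfolding fin_gen_group_def by blast
  have "carrier H \<subseteq> h ` M <#>\<^bsub>H\<^esub> h ` T"
  proof
    fix x assume "x \<in> carrier H"
    then obtain m t where "m \<in> M" "t \<in> T" "x = h m \<otimes>\<^bsub>H\<^esub> h t" using cover by blast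
    then show "x \<in> h ` M <#>\<^bsub>H\<^esub> h ` T" by (simp add: set_multI)
  qed
  then have "virtually_contains H (h ` M) (carrier H)"
    using T(1,2) unfolding virtually_contains_def by (intro exI[of _ "h ` T"]) auto
  moreover have "comm_group (H\<lparr>carrier := h ` M\<rparr>)"
    using M Mc G.subgroup_comm_group_iff[OF M(1)] H.subgroup_comm_group_iff[OF hM]
    by (auto simp flip: hom_mult simp: subsetD)
  ultimately show "virtually_abelian H"
    using hM unfolding virtually_abelian_def H.finite_index_subgroup_iff by blast
qed

text \<open>What is pulled back is the kernel of the retraction \<open>\<rho>\<close>:
  \<open>K\<close> is the preimage of its domain, and \<open>R\<close> the kernel of
  \<open>\<rho> \<circ> h\<close> on \<open>K\<close>. An element of \<open>U \<inter> R\<close> is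
  in the kernel of \<open>h\<close> because \<open>\<rho>\<close> fixes its image.\<close>

lemma (in group_hom) pullback_retract:
  assumes U: "subgroup U G" and retr: "virtual_retract (h ` U) H"
  obtains K R where "subgroup K G" "virtually_contains G K (carrier G)" "K \<subseteq> U <#> R"
    "subgroup R G" "\<And>u r. \<lbrakk> u \<in> U; r \<in> R \<rbrakk> \<Longrightarrow> u \<otimes> r \<otimes> inv u \<in> R"
    "U \<inter> R \<subseteq> kernel G H h" "kernel G H h \<subseteq> R"
proof -
  obtain K' \<rho> where K': "subgroup K' H" "virtually_contains H K' (carrier H)" "h ` U \<subseteq> K'"
    and \<rho>: "\<rho> \<in> hom (H\<lparr>carrier := K'\<rparr>) (H\<lparr>carrier := h ` U\<rparr>)" "\<And>x. x \<in> U \<Longrightarrow> \<rho> (h x) = h x"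
    using retr unfolding virtual_retract_def H.finite_index_subgroup_iff by auto
  have Uc: "U \<subseteq> carrier G" using U by (rule subgroup.subset)
  have hU: "subgroup (h ` U) H" using U by (rule subgroup_img_is_subgroup)
  interpret \<rho>: group_hom "H\<lparr>carrier := K'\<rparr>" "H\<lparr>carrier := h ` U\<rparr>" \<rho>
    using K'(1) hU \<rho>(1) by (simp add: group_hom_def group_hom_axioms_def H.subgroup_imp_group)
  have \<rho>_mult: "\<rho> (x \<otimes>\<^bsub>H\<^esub> y) = \<rho> x \<otimes>\<^bsub>H\<^esub> \<rho> y" if "x \<in> K'" "y \<in> K'" for x y
    using \<rho>.hom_mult that by simp
  have \<rho>_closed: "\<rho> x \<in> h ` U" if "x \<in> K'" for x
    using \<rho>.hom_closed that by simp
  have \<rho>_inv: "\<rho> (inv\<^bsub>H\<^esub> x) = inv\<^bsub>H\<^esub> (\<rho> x)" if "x \<in> K'" for x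
    using \<rho>.hom_inv[of x] that \<rho>_closed[OF that] K'(1) hU by simp
  define K where "K = {x \<in> carrier G. h x \<in> K'}"
  define R where "R = {x \<in> K. \<rho> (h x) = \<one>\<^bsub>H\<^esub>}"
  have K: "subgroup K G"
    using K'(1) subgroup.one_closed[OF K'(1)]
    by (intro G.subgroupI)
      (auto simp: K_def subgroup.m_closed subgroup.m_inv_closed intro!: exI[of _ \<one>])
  have R: "subgroup R G"
  proof (rule G.subgroupI)
    show "R \<noteq> {}"
      using \<rho>.hom_one subgroup.one_closed[OF K] by (auto simp: R_def intro!: exI[of _ \<one>])
  qed (use K in \<open>auto simp: R_def K_def \<rho>_mult \<rho>_inv subgroup.m_closed[OF K'(1)]
         subgroup.m_inv_closed[OF K'(1)]\<close>)
  have UK: "U \<subseteq> K" using K'(3) Uc by (auto simp: K_def)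
  have "virtually_contains G K (carrier G)"
  proof (rule G.virtually_containsI[OF order_refl])
    have "(\<lambda>x. K' #>\<^bsub>H\<^esub> h x) ` carrier G \<subseteq> (\<lambda>x. K' #>\<^bsub>H\<^esub> x) ` carrier H" by auto
    then show "finite ((\<lambda>x. K' #>\<^bsub>H\<^esub> h x) ` carrier G)"
      using H.virtually_contains_finite_cosets[OF K'(1,2)] finite_subset by blast
    fix x y assume xy: "x \<in> carrier G" "y \<in> carrier G" "K' #>\<^bsub>H\<^esub> h x = K' #>\<^bsub>H\<^esub> h y"
    then show "x \<otimes> inv y \<in> K" using H.r_coset_eqD[OF K'(1) _ _ xy(3)] by (simp add: K_def)
  qed
  moreover have "K \<subseteq> U <#> R"
  proof
    fix x assume x: "x \<in> K"
    then have hx: "h x \<in> K'" "x \<in> carrier G" by (auto simp: K_def)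
    \<comment> \<open>Since \<open>\<rho>\<close> fixes \<open>h u\<close>, both \<open>x\<close>
      and \<open>u\<close> have the same value under \<open>\<rho> \<circ> h\<close>, so
      \<open>inv u \<otimes> x\<close> lies in \<open>R\<close>.\<close>
    obtain u where u: "u \<in> U" "\<rho> (h x) = h u" using \<rho>_closed[OF hx(1)] by auto
    have uc: "u \<in> carrier G" and hu: "h u \<in> K'" using u Uc K'(3) by auto
    have "inv u \<otimes> x \<in> R"
      using x u uc hu hx \<rho>(2)[OF u(1)] K UK
      by (auto simp: R_def subgroup.m_closed subgroup.m_inv_closed \<rho>_mult \<rho>_inv
          subgroup.m_inv_closed[OF K'(1)])
    moreover have "x = u \<otimes> (inv u \<otimes> x)" using uc hx by simp
    ultimately show "x \<in> U <#> R" using u(1) by (metis set_multI)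
  qed
  moreover have "u \<otimes> r \<otimes> inv u \<in> R" if "u \<in> U" "r \<in> R" for u r
  proof -
    have c: "u \<in> carrier G" "r \<in> carrier G" "h u \<in> K'" "h r \<in> K'" "\<rho> (h r) = \<one>\<^bsub>H\<^esub>"
      using that Uc K'(3) by (auto simp: R_def K_def)
    then show ?thesis
      using \<rho>(2)[OF that(1)] by (auto simp: R_def K_def \<rho>_mult \<rho>_inv subgroup.m_closed[OF K'(1)]
         subgroup.m_inv_closed[OF K'(1)])
  qed
  moreover have "U \<inter> R \<subseteq> kernel G H h"
    using Uc \<rho>(2) by (auto simp: R_def kernel_def)
  moreover have "kernel G H h \<subseteq> R"
    using \<rho>.hom_one subgroup.one_closed[OF K'(1)] by (auto simp: R_def K_def kernel_def)
  ultimately show thesis using that K R by blast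
qed

subsection \<open>Normal virtual retracts\<close>

context group begin

text \<open>The retraction takes values in \<open>N\<close>; \<open>K0\<close> is the part sent into
  \<open>M\<close>, still of finite index, and \<open>K1\<close> is its normal core. There
  \<open>\<rho>\<close> is a map to \<open>M\<close> commuting with conjugation by
  \<open>K1\<close>, and averaging over \<open>G\<close> yields the normal subgroup
  \<open>L\<close>.\<close>

lemma normal_almost_complement:
  assumes N: "N \<lhd> G" "virtual_retract N G"
    and M: "M \<lhd> G" "M \<subseteq> N" "virtually_contains G M N"
      "comm_group (G\<lparr>carrier := M\<rparr>)" "torsion_free_on G M"
    and Y: "finite Y" "Y \<subseteq> M" "generate G Y = M"
  obtains L where "L \<lhd> G" "L \<inter> N = {\<one>}" "virtually_contains G (M <#> L) (carrier G)"
proof -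
  have Ns: "subgroup N G" and Ms: "subgroup M G" using N M by (auto dest: normal_imp_subgroup)
  have Nc: "N \<subseteq> carrier G" using Ns by (rule subgroup.subset)
  obtain K \<rho> where K: "subgroup K G" "virtually_contains G K (carrier G)" "N \<subseteq> K"
    and \<rho>: "\<rho> \<in> hom (G\<lparr>carrier := K\<rparr>) (G\<lparr>carrier := N\<rparr>)" "\<And>x. x \<in> N \<Longrightarrow> \<rho> x = x"
    using N(2) unfolding virtual_retract_def finite_index_subgroup_iff by auto
  have Kc: "K \<subseteq> carrier G" using K(1) by (rule subgroup.subset)
  interpret \<rho>: group_hom "G\<lparr>carrier := K\<rparr>" "G\<lparr>carrier := N\<rparr>" \<rho>
    using K(1) Ns \<rho>(1) by (simp add: group_hom_def group_hom_axioms_def subgroup_imp_group)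
  have \<rho>_mult: "\<rho> (x \<otimes> y) = \<rho> x \<otimes> \<rho> y" if "x \<in> K" "y \<in> K" for x y
    using \<rho>.hom_mult that by simp
  have \<rho>_closed: "\<rho> x \<in> N" if "x \<in> K" for x
    using \<rho>.hom_closed that by simp
  have \<rho>_inv: "\<rho> (inv x) = inv (\<rho> x)" if "x \<in> K" for x
    using \<rho>.hom_inv[of x] that \<rho>_closed[OF that] K(1) Ns by simp
  define K0 where "K0 = {x \<in> K. \<rho> x \<in> M}"
  have MK0: "M \<subseteq> K0" using M(2) K(3) \<rho>(2) by (auto simp: K0_def)
  have K0: "subgroup K0 G"
  proof (rule subgroupI)
    show "K0 \<noteq> {}" using MK0 subgroup.one_closed[OF Ms] by auto
  qed (use K(1) Kc Ms in \<open>auto simp: K0_def \<rho>_mult \<rho>_inv subgroup.m_closed subgroup.m_inv_closed\<close>)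
  have "virtually_contains G K0 K"
  proof (rule virtually_containsI[OF Kc])
    have "(\<lambda>x. M #> \<rho> x) ` K \<subseteq> (\<lambda>x. M #> x) ` N" using \<rho>_closed by auto
    then show "finite ((\<lambda>x. M #> \<rho> x) ` K)"
      using virtually_contains_finite_cosets[OF Ms M(3)] finite_subset by blast
    fix x y assume xy: "x \<in> K" "y \<in> K" "M #> \<rho> x = M #> \<rho> y"
    then have "\<rho> x \<otimes> inv (\<rho> y) \<in> M"
      using r_coset_eqD[OF Ms _ _ xy(3)] \<rho>_closed Nc by blast
    then show "x \<otimes> inv y \<in> K0"
      using xy K(1) by (simp add: K0_def \<rho>_mult \<rho>_inv subgroup.m_closed subgroup.m_inv_closed)
  qed
  then have fin0: "virtually_contains G K0 (carrier G)"
    using virtually_contains_trans[OF _ _ K(2)] K0 by (simp add: subgroup.subset)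
  define K1 where "K1 = {x \<in> carrier G. \<forall>g\<in>carrier G. g \<otimes> x \<otimes> inv g \<in> K0}"
  have K1: "K1 \<lhd> G" "K1 \<subseteq> K0" "virtually_contains G K1 (carrier G)"
    unfolding K1_def using normal_core[OF K0 fin0] by auto
  have K1s: "subgroup K1 G" using K1(1) by (rule normal_imp_subgroup)
  have MK1: "M \<subseteq> K1"
    using MK0 subgroup.subset[OF Ms] M(1) by (auto simp: K1_def normal.inv_op_closed2)
  have K1K: "x \<in> K" "\<rho> x \<in> M" if "x \<in> K1" for x using that K1(2) by (auto simp: K0_def)
  have equiv: "\<rho> (k \<otimes> x \<otimes> inv k) = k \<otimes> \<rho> x \<otimes> inv k" if "k \<in> K1" "x \<in> K1" for k x
  proof -
    have c: "k \<in> K" "x \<in> K" "inv k \<in> K" "\<rho> x \<in> K" "\<rho> x \<in> N" "k \<in> carrier G"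
      using that K1K K \<rho>_closed Kc by (auto simp: subgroup.m_inv_closed)
    \<comment> \<open>\<open>\<rho>\<close> fixes \<open>\<rho> x \<in> N\<close>, so
      \<open>x\<close> may be replaced by \<open>\<rho> x\<close>. By normality the conjugate of
      \<open>\<rho> x\<close> by \<open>k\<close> is again in \<open>N\<close>, where
      \<open>\<rho>\<close> is the identity.\<close>
    have "\<rho> (k \<otimes> x \<otimes> inv k) = \<rho> k \<otimes> \<rho> (\<rho> x) \<otimes> \<rho> (inv k)"
      using c \<rho>(2) K(1) by (simp add: \<rho>_mult subgroup.m_closed)
    also have "\<dots> = \<rho> (k \<otimes> \<rho> x \<otimes> inv k)"
      using c K(1) by (simp add: \<rho>_mult subgroup.m_closed)
    also have "\<dots> = k \<otimes> \<rho> x \<otimes> inv k"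
      using normal.inv_op_closed2[OF N(1) c(6,5)] by (rule \<rho>(2))
    finally show ?thesis .
  qed
  obtain L where L: "subgroup L G" "L \<subseteq> K1" "M \<inter> L = {\<one>}" "virtually_contains G (M <#> L) K1"
    "\<And>g l. \<lbrakk> g \<in> carrier G; l \<in> L \<rbrakk> \<Longrightarrow> g \<otimes> l \<otimes> inv g \<in> L"
  \<comment> \<open>\<open>K1\<close> serves both as the domain and as the finite index subgroup of
    equivariance; the exponent is 1 because \<open>\<rho>\<close> is the identity on
    \<open>M\<close>.\<close>
  proof (rule equivariant_complement[of "carrier G" K1 M \<rho> 1 K1])
    show "virtually_contains G ((\<lambda>x. x [^] n) ` M) M" if "n > 0" for n :: nat
      using virtually_contains_powers_subgroup[OF Ms M(4) Y Ms order_refl that] .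
    show "\<rho> c = c [^] (1::nat)" if "c \<in> M" for c
      using that M(2) \<rho>(2) subgroup.subset[OF Ms] by (auto simp: subsetD)
  qed (use K1 K1s M Ms MK1 K1K equiv \<rho>_mult subgroup_self subgroup.subset[OF K1s] in
        \<open>auto simp: normal.inv_op_closed2\<close>)
  \<comment> \<open>An \<open>x\<close> in both is fixed by \<open>\<rho>\<close>, while
    \<open>L \<subseteq> K1\<close> gives \<open>\<rho> x \<in> M\<close>; hence
    \<open>x \<in> M \<inter> L\<close>.\<close>
  have "L \<inter> N = {\<one>}"
  proof
    show "L \<inter> N \<subseteq> {\<one>}"
    proof
      fix x assume x: "x \<in> L \<inter> N"
      then have "\<rho> x \<in> M" using L(2) K1K(2) by blast
      then show "x \<in> {\<one>}" using x \<rho>(2) L(3) by auto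
    qed
  qed (use subgroup.one_closed[OF L(1)] subgroup.one_closed[OF Ns] in auto)
  moreover have "virtually_contains G (M <#> L) (carrier G)"
    using virtually_contains_trans[OF _ L(4) K1(3)] Ms L(1)
    by (simp add: setmult_subset_G subgroup.subset)
  moreover have "L \<lhd> G" using L(5) by (rule normal_invI[OF L(1)])
  ultimately show thesis using that by blast
qed

text \<open>The complement of \<open>H\<close> is assembled from two pieces: \<open>P\<close> inside
  \<open>M\<close>, from averaging over \<open>H\<close>, and \<open>R \<inter> L\<close>, where
  \<open>R\<close> is pulled back from the retraction in \<open>G Mod N\<close>.\<close>

lemma virtual_retract_lift:
  assumes N: "N \<lhd> G"
    and M: "M \<lhd> G" "M \<subseteq> N" "comm_group (G\<lparr>carrier := M\<rparr>)" "torsion_free_on G M"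
    and Y: "finite Y" "Y \<subseteq> M" "generate G Y = M"
    and L: "L \<lhd> G" "L \<inter> N = {\<one>}" "virtually_contains G (M <#> L) (carrier G)"
    and H: "subgroup H G" and retr: "virtual_retract ((\<lambda>x. N #> x) ` H) (G Mod N)"
  shows "virtual_retract H G"
proof -
  have Ns: "subgroup N G" and Ms: "subgroup M G" and Ls: "subgroup L G"
    using N M L by (auto dest: normal_imp_subgroup)
  have Nc: "N \<subseteq> carrier G" and Mc: "M \<subseteq> carrier G" and Lc: "L \<subseteq> carrier G" and Hc: "H \<subseteq> carrier G"
    using Ns Ms Ls H by (auto dest: subgroup.subset)
  have LM: "subgroup (M <#> L) G"
    by (rule subgroup_semidirect[OF Ms Ls normal.inv_op_closed2[OF L(1) subsetD[OF Mc]]])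
  \<comment> \<open>Both subgroups are normal, so the commutator of \<open>l\<close> and
    \<open>x\<close> lies in \<open>L \<inter> N\<close>, which is trivial.\<close>
  have comm_LN: "l \<otimes> x = x \<otimes> l" if "l \<in> L" "x \<in> N" for l x
  proof -
    have c: "l \<in> carrier G" "x \<in> carrier G" using that Lc Nc by auto
    let ?z = "(l \<otimes> x \<otimes> inv l) \<otimes> inv x"
    have "?z \<in> N"
      using that c N Ns by (simp add: normal.inv_op_closed2 subgroup.m_closed subgroup.m_inv_closed)
    moreover have "?z = l \<otimes> (x \<otimes> inv l \<otimes> inv x)" using c by (simp add: m_assoc)
    then have "?z \<in> L"
      using that c L(1) Ls by (simp add: normal.inv_op_closed2 subgroup.m_closed subgroup.m_inv_closed)
    ultimately have "l \<otimes> x \<otimes> inv l \<otimes> inv x = \<one>" using L(2) by auto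
    then have "l \<otimes> x \<otimes> inv (x \<otimes> l) = \<one>" using c by (simp add: group_normalize)
    then show ?thesis using c by (metis inv_equality inv_inv inv_closed m_closed)
  qed
  have MH: "subgroup (M \<inter> H) G" using Ms H by (rule subgroups_Inter_pair)
  obtain \<phi> m where \<phi>: "m > (0::nat)" "\<And>x. x \<in> M \<Longrightarrow> \<phi> x \<in> M \<inter> H"
    "\<And>x y. \<lbrakk> x \<in> M; y \<in> M \<rbrakk> \<Longrightarrow> \<phi> (x \<otimes> y) = \<phi> x \<otimes> \<phi> y"
    "\<And>c. c \<in> M \<inter> H \<Longrightarrow> \<phi> c = c [^] m"
    by (rule power_map_onto_subgroup[OF Ms M(3) Y MH Int_lower1]) blast
  have trivial_action: "u \<otimes> x \<otimes> inv u = x" if "u \<in> M <#> L" "x \<in> M" for u x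
  proof -
    from that(1) obtain a l where u: "a \<in> M" "l \<in> L" "u = a \<otimes> l" by (rule set_multE)
    have c: "a \<in> carrier G" "l \<in> carrier G" "x \<in> carrier G" using u that Mc Lc by auto
    have 1: "l \<otimes> x = x \<otimes> l" "a \<otimes> x = x \<otimes> a"
      using comm_LN u that M(2) subgroup_comm_group_iff[OF Ms] M(3) by auto
    have "u \<otimes> x = a \<otimes> (l \<otimes> x)" using u(3) c by (simp add: m_assoc)
    also have "\<dots> = (a \<otimes> x) \<otimes> l" using 1(1) c by (simp add: m_assoc)
    also have "\<dots> = x \<otimes> u" using 1(2) u(3) c by (simp add: m_assoc)
    finally show ?thesis using u(3) c by (simp add: m_assoc)
  qed
  obtain P where P: "subgroup P G" "P \<subseteq> M" "(M \<inter> H) \<inter> P = {\<one>}"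
    "virtually_contains G ((M \<inter> H) <#> P) M"
    "\<And>h p. \<lbrakk> h \<in> H; p \<in> P \<rbrakk> \<Longrightarrow> h \<otimes> p \<otimes> inv h \<in> P"
  \<comment> \<open>Conjugation by \<open>M <#> L\<close> is trivial on \<open>M\<close>, so
    \<open>\<phi>\<close> is automatically equivariant under \<open>H \<inter> (M <#> L)\<close>,
    which has finite index in \<open>H\<close>.\<close>
  proof (rule equivariant_complement[of H M "M \<inter> H" \<phi> m "H \<inter> (M <#> L)"])
    show "virtually_contains G ((\<lambda>x. x [^] n) ` (M \<inter> H)) (M \<inter> H)" if "n > 0" for n :: nat
      using virtually_contains_powers_subgroup[OF Ms M(3) Y MH _ that] by simp
    show "comm_group (G\<lparr>carrier := M \<inter> H\<rparr>)"
      using M(3) subgroup_comm_group_iff[OF Ms] subgroup_comm_group_iff[OF MH] by blast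
    show "torsion_free_on G (M \<inter> H)" using M(4) by (auto simp: torsion_free_on_def)
    show "subgroup (H \<inter> (M <#> L)) G" using H LM by (rule subgroups_Inter_pair)
    have "virtually_contains G (M <#> L) H" using virtually_contains_mono[OF L(3) order_refl Hc] .
    then show "virtually_contains G (H \<inter> (M <#> L)) H"
      using virtually_contains_Int[OF H virtually_contains_refl LM] Hc by blast
    show "\<phi> (u \<otimes> x \<otimes> inv u) = u \<otimes> \<phi> x \<otimes> inv u" if "u \<in> H \<inter> (M <#> L)" "x \<in> M" for u x
      using that \<phi>(2) trivial_action by auto
    show "h \<otimes> x \<otimes> inv h \<in> M" if "h \<in> H" "x \<in> M" for h x
      using that Hc M(1) by (auto simp: normal.inv_op_closed2)
    then show "h \<otimes> x \<otimes> inv h \<in> M \<inter> H" if "h \<in> H" "x \<in> M \<inter> H" for h x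
      using that H by (auto simp: subgroup.m_closed subgroup.m_inv_closed)
  qed (use \<phi> H Ms MH in auto)
  interpret Q: group_hom G "G Mod N" "\<lambda>x. N #> x"
    using normal.r_coset_hom_Mod[OF N] normal.factorgroup_is_group[OF N]
    by (simp add: group_hom_def group_hom_axioms_def)
  have ker: "kernel G (G Mod N) (\<lambda>x. N #> x) = N"
    using coset_join1[OF _ _ Ns] coset_join2[OF _ Ns] Nc by (auto simp: kernel_def)
  obtain K R where K: "subgroup K G" "virtually_contains G K (carrier G)" "K \<subseteq> H <#> R"
    and R: "subgroup R G" "\<And>u r. \<lbrakk> u \<in> H; r \<in> R \<rbrakk> \<Longrightarrow> u \<otimes> r \<otimes> inv u \<in> R"
      "H \<inter> R \<subseteq> N" "N \<subseteq> R"
    using Q.pullback_retract[OF H retr] unfolding ker by metis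
  have Rc: "R \<subseteq> carrier G" and Pc: "P \<subseteq> carrier G" using R(1) P(1) by (auto dest: subgroup.subset)
  have PR: "P \<subseteq> R" using P(2) M(2) R(4) by blast
  have RL: "subgroup (R \<inter> L) G" using R(1) Ls by (rule subgroups_Inter_pair)
  \<comment> \<open>As \<open>P \<subseteq> N \<subseteq> R\<close>, this makes \<open>P\<close>
    normalise \<open>R \<inter> L\<close>, so their product \<open>F\<close> is a subgroup.\<close>
  have conj_RL: "r \<otimes> l \<otimes> inv r \<in> R \<inter> L" if "r \<in> R" "l \<in> R \<inter> L" for r l
    using that R(1) Rc L(1) by (auto simp: subgroup.m_closed subgroup.m_inv_closed normal.inv_op_closed2)
  define F where "F = P <#> (R \<inter> L)"
  have F: "subgroup F G"
    unfolding F_def using P(1) RL conj_RL PR by (intro subgroup_semidirect) blast+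
  have HF: "h \<otimes> f \<otimes> inv h \<in> F" if h: "h \<in> H" and f: "f \<in> F" for h f
  proof -
    obtain p l where pl: "p \<in> P" "l \<in> R \<inter> L" "f = p \<otimes> l" using f unfolding F_def by (rule set_multE)
    have c: "h \<in> carrier G" "p \<in> carrier G" "l \<in> carrier G" using h pl Hc Pc Lc by auto
    have "h \<otimes> f \<otimes> inv h = (h \<otimes> p \<otimes> inv h) \<otimes> (h \<otimes> l \<otimes> inv h)"
      using pl(3) c by (simp add: group_normalize)
    moreover have "h \<otimes> l \<otimes> inv h \<in> R \<inter> L"
      using R(2)[OF h] pl(2) c L(1) by (auto simp: normal.inv_op_closed2)
    ultimately show ?thesis using P(5)[OF h pl(1)] by (simp add: F_def set_multI)
  qed
  have PF: "P \<subseteq> F" and RLF: "R \<inter> L \<subseteq> F"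
  proof -
    show "P \<subseteq> F"
      using set_multI[OF _ subgroup.one_closed[OF RL], of _ P G] Pc by (fastforce simp: F_def)
    show "R \<inter> L \<subseteq> F"
      using set_multI[OF subgroup.one_closed[OF P(1)], of _ "R \<inter> L" G] Lc by (fastforce simp: F_def)
  qed
  let ?Z = "H <#> F"
  have Z: "subgroup ?Z G" using subgroup_semidirect[OF H F HF] .
  have HZ: "H \<subseteq> ?Z" and FZ: "F \<subseteq> ?Z"
  proof -
    show "H \<subseteq> ?Z"
      using set_multI[OF _ subgroup.one_closed[OF F], of _ H G] Hc by fastforce
    show "F \<subseteq> ?Z"
      using set_multI[OF subgroup.one_closed[OF H], of _ F G] subgroup.subset[OF F] by fastforce
  qed
  have Zc: "?Z \<subseteq> carrier G" using Z by (rule subgroup.subset)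
  \<comment> \<open>Finite index of \<open>?Z\<close> is climbed in stages: \<open>M\<close>, then
    \<open>(R \<inter> L) <#> M\<close>, \<open>R\<close>, \<open>H <#> R\<close>, \<open>K\<close>
    and finally \<open>G\<close>.\<close>
  have "(M \<inter> H) <#> P \<subseteq> ?Z" using PF by (intro mono_set_mult) auto
  then have "virtually_contains G ?Z M" using virtually_contains_mono[OF P(4)] by blast
  then have "virtually_contains G ?Z ((R \<inter> L) <#> M)"
    using virtually_contains_absorb[OF Z] RLF FZ by blast
  moreover have "virtually_contains G ((R \<inter> L) <#> M) R"
  proof (rule virtually_contains_mono[OF _ _ order_refl])
    show "virtually_contains G ((M <#> L) \<inter> R) R"
      using virtually_contains_Int[OF LM _ R(1) virtually_contains_refl[OF Rc] Rc]
        virtually_contains_mono[OF L(3) order_refl Rc] by blast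
    \<comment> \<open>The modular law: \<open>M \<subseteq> R\<close>, so the
      \<open>L\<close>-factor of an element of \<open>R\<close> is itself in
      \<open>R\<close>.\<close>
    show "(M <#> L) \<inter> R \<subseteq> (R \<inter> L) <#> M"
    proof
      fix x assume x: "x \<in> (M <#> L) \<inter> R"
      then obtain a l where al: "a \<in> M" "l \<in> L" "x = a \<otimes> l" by (auto elim: set_multE)
      have aN: "a \<in> N" using al(1) M(2) by auto
      have c: "a \<in> carrier G" "l \<in> carrier G" using al Mc Lc by auto
      have "l = inv a \<otimes> x" using al(3) c by simp
      then have "l \<in> R" using x aN R(1,4) by (auto simp: subgroup.m_closed subgroup.m_inv_closed)
      moreover have "x = l \<otimes> a" using comm_LN[OF al(2) aN] al(3) by simp
      ultimately show "x \<in> (R \<inter> L) <#> M" using al by (simp add: set_multI)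
    qed
  qed
  ultimately have "virtually_contains G ?Z R" by (rule virtually_contains_trans[OF Zc])
  then have "virtually_contains G ?Z (H <#> R)" by (rule virtually_contains_absorb[OF Z HZ])
  then have "virtually_contains G ?Z K" using virtually_contains_mono K(3) by blast
  then have fin: "virtually_contains G ?Z (carrier G)"
    using K(2) by (rule virtually_contains_trans[OF Zc])
  \<comment> \<open>If \<open>x = p \<otimes> l\<close> is in \<open>H\<close>, then
    \<open>x \<in> H \<inter> R \<subseteq> N\<close>, so \<open>l \<in> L \<inter> N\<close> is
    trivial and \<open>x = p\<close> lies in \<open>H \<inter> P\<close>.\<close>
  have "H \<inter> F = {\<one>}"
  proof
    show "H \<inter> F \<subseteq> {\<one>}"
    proof
      fix x assume x: "x \<in> H \<inter> F"
      then obtain p l where pl: "p \<in> P" "l \<in> R" "l \<in> L" "x = p \<otimes> l"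
        unfolding F_def by (auto elim: set_multE)
      have c: "p \<in> carrier G" "l \<in> carrier G" using pl Pc Lc by auto
      have "x \<in> R" using pl PR R(1) by (auto intro: subgroup.m_closed)
      then have "x \<in> N" using x R(3) by auto
      moreover have "p \<in> N" using pl(1) P(2) M(2) by auto
      moreover have "l = inv p \<otimes> x" using pl(4) c by simp
      ultimately have "l \<in> N" using Ns by (simp add: subgroup.m_closed subgroup.m_inv_closed)
      then have "l = \<one>" using pl(3) L(2) by auto
      then have "x = p" using pl(4) c by simp
      then show "x \<in> {\<one>}" using x pl(1) P(2,3) by auto
    qed
  qed (use subgroup.one_closed[OF H] subgroup.one_closed[OF F] in auto)
  then show ?thesis using virtual_retractI[OF H F HF _ fin] by blast
qed

end

(* A has its elements in nat: every finitely generated group is countable, hence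
   isomorphic to such a group. *)
theorem corollary4p4:
  fixes G :: "('a, 'b) monoid_scheme" and N :: "'a set"
  assumes "group G"
    and "N \<lhd> G"
    and "virtual_retract N G"
    and "fin_gen_group (G\<lparr>carrier := N\<rparr>)"
    and "virtually_abelian (G\<lparr>carrier := N\<rparr>)"
  shows "(\<exists>(A :: nat monoid) \<iota>. fin_gen_group A \<and> virtually_abelian A \<and>
             \<iota> \<in> mon G ((G Mod N) \<times>\<times> A)) \<and>
         (property_LR (G Mod N) \<longrightarrow> property_LR G)"
proof -
  interpret group G by (rule assms(1))
  have N: "subgroup N G" using assms(2) by (rule normal_imp_subgroup)
  have Nc: "N \<subseteq> carrier G" using N by (rule subgroup.subset)
  interpret N: group "G\<lparr>carrier := N\<rparr>" using N by (rule subgroup_imp_group)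
  obtain S where S: "finite S" "S \<subseteq> N" "generate G S = N"
    using assms(4) generate_consistent[OF _ N] unfolding fin_gen_group_def by auto
  obtain B where B: "subgroup B (G\<lparr>carrier := N\<rparr>)"
    "virtually_contains (G\<lparr>carrier := N\<rparr>) B N" "comm_group (G\<lparr>carrier := B\<rparr>)"
    using assms(5) unfolding virtually_abelian_def N.finite_index_subgroup_iff by auto
  have B': "subgroup B G" "B \<subseteq> N" "virtually_contains G B N"
    using incl_subgroup[OF N B(1)] subgroup.subset[OF B(1)] virtually_contains_subgroupD[OF B(2) Nc]
    by auto
  have Sc: "S \<subseteq> carrier G" using S(2) Nc by blast
  obtain M Y where M: "M \<lhd> G" "M \<subseteq> N" "virtually_contains G M N" "comm_group (G\<lparr>carrier := M\<rparr>)"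
    "torsion_free_on G M" and Y: "finite Y" "Y \<subseteq> M" "generate G Y = M"
    by (rule torsion_free_normal_abelian[OF assms(2) S(1) Sc S(3) B' B(3)])
  obtain L where L: "L \<lhd> G" "L \<inter> N = {\<one>\<^bsub>G\<^esub>}" "virtually_contains G (M <#>\<^bsub>G\<^esub> L) (carrier G)"
    by (rule normal_almost_complement[OF assms(2,3) M Y])
  have Ms: "subgroup M G" and Ls: "subgroup L G" using M L by (auto dest: normal_imp_subgroup)
  have hom_Mod: "group_hom G (G Mod V) (\<lambda>x. V #>\<^bsub>G\<^esub> x)" if "V \<lhd> G" for V
    using normal.r_coset_hom_Mod[OF that] normal.factorgroup_is_group[OF that]
    by (simp add: group_hom_def group_hom_axioms_def)
  have ker_Mod: "x \<in> V" if "V \<lhd> G" "x \<in> carrier G" "V #>\<^bsub>G\<^esub> x = V" for V x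
    using that coset_join1 by (metis normal_imp_subgroup subgroup.subset)
  interpret QL: group_hom G "G Mod L" "\<lambda>x. L #>\<^bsub>G\<^esub> x" by (rule hom_Mod[OF L(1)])
  have Lker: "L \<subseteq> kernel G (G Mod L) (\<lambda>x. L #>\<^bsub>G\<^esub> x)"
    using subgroup.subset[OF Ls] coset_join2[OF _ Ls] by (auto simp: kernel_def)
  \<comment> \<open>Finite generation makes \<open>G Mod L\<close> countable, which provides the
    copy \<open>A\<close>. The image lemma is applied again to the composite \<open>?\<pi>\<close>
    to obtain both properties for \<open>A\<close> itself.\<close>
  have "fin_gen_group (G Mod L)"
    using QL.image_fin_gen_virtually_abelian(1)[OF _ Ms M(4) Y Lker L(3)] by (simp add: carrier_FactGroup)
  then obtain A :: "nat monoid" and f where A: "group A" "f \<in> iso (G Mod L) A"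
    using group.nat_isomorphic_copy[OF QL.H.is_group fin_gen_group_countable] by blast
  let ?\<pi> = "\<lambda>x. f (L #>\<^bsub>G\<^esub> x)"
  have fhom: "f \<in> hom (G Mod L) A" and fbij: "bij_betw f (carrier (G Mod L)) (carrier A)"
    using A(2) by (auto simp: iso_def)
  have \<pi>hom: "?\<pi> \<in> hom G A"
    using Group.hom_compose[OF QL.homh fhom] by (simp add: comp_def)
  interpret \<pi>: group_hom G A ?\<pi>
    using A(1) \<pi>hom by (simp add: group_hom_def group_hom_axioms_def)
  have "?\<pi> ` carrier G = carrier A"
    using fbij by (auto simp: bij_betw_def carrier_FactGroup image_image)
  moreover have "L \<subseteq> kernel G A ?\<pi>"
    using Lker hom_one[OF fhom QL.H.is_group A(1)] by (auto simp: kernel_def)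
  ultimately have "fin_gen_group A" "virtually_abelian A"
    using \<pi>.image_fin_gen_virtually_abelian[OF _ Ms M(4) Y _ L(3)] by auto
  \<comment> \<open>The paired map has kernel \<open>N \<inter> L\<close>, which is trivial.\<close>
  moreover have "(\<lambda>x. (N #>\<^bsub>G\<^esub> x, ?\<pi> x)) \<in> mon G ((G Mod N) \<times>\<times> A)"
  proof -
    interpret QN: group_hom G "G Mod N" "\<lambda>x. N #>\<^bsub>G\<^esub> x" by (rule hom_Mod[OF assms(2)])
    have hom: "(\<lambda>x. (N #>\<^bsub>G\<^esub> x, ?\<pi> x)) \<in> hom G ((G Mod N) \<times>\<times> A)"
      using QN.homh \<pi>hom by (simp add: hom_paired)
    have "x = \<one>\<^bsub>G\<^esub>" if x: "x \<in> carrier G" "N #>\<^bsub>G\<^esub> x = \<one>\<^bsub>G Mod N\<^esub>" "?\<pi> x = \<one>\<^bsub>A\<^esub>" for x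
    proof -
      have "f (L #>\<^bsub>G\<^esub> x) = f \<one>\<^bsub>G Mod L\<^esub>" using x(3) hom_one[OF fhom QL.H.is_group A(1)] by simp
      then have "L #>\<^bsub>G\<^esub> x = \<one>\<^bsub>G Mod L\<^esub>"
        using fbij QL.hom_closed[OF x(1)] QL.H.one_closed unfolding bij_betw_def by (metis inj_onD)
      then have "x \<in> L \<inter> N" using ker_Mod L(1) assms(2) x by auto
      then show ?thesis using L(2) by auto
    qed
    then show ?thesis
      using hom mon_iff_hom_one[OF is_group DirProd_group[OF QN.H.is_group A(1)]] by auto
  qed
  moreover have "property_LR G" if LR: "property_LR (G Mod N)"
    unfolding property_LR_def
  proof (intro conjI allI impI is_group, elim conjE)
    fix H assume H: "subgroup H G" "fin_gen_group (G\<lparr>carrier := H\<rparr>)"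
    interpret QN: group_hom G "G Mod N" "\<lambda>x. N #>\<^bsub>G\<^esub> x" by (rule hom_Mod[OF assms(2)])
    let ?J = "(\<lambda>x. N #>\<^bsub>G\<^esub> x) ` H"
    have J: "subgroup ?J (G Mod N)" using H(1) by (rule QN.subgroup_img_is_subgroup)
    obtain T where T: "finite T" "T \<subseteq> H" "generate G T = H"
      using H(2) generate_consistent[OF _ H(1)] unfolding fin_gen_group_def by auto
    have "generate (G Mod N) ((\<lambda>x. N #>\<^bsub>G\<^esub> x) ` T) = ?J"
      using QN.generate_img[of T] T subgroup.subset[OF H(1)] by auto
    then have "generate ((G Mod N)\<lparr>carrier := ?J\<rparr>) ((\<lambda>x. N #>\<^bsub>G\<^esub> x) ` T) = ?J"
      using QN.H.generate_consistent[OF image_mono[OF T(2)] J] by simp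
    then have "fin_gen_group ((G Mod N)\<lparr>carrier := ?J\<rparr>)"
      unfolding fin_gen_group_def using T QN.H.subgroup_imp_group[OF J]
      by (intro conjI exI[of _ "(\<lambda>x. N #>\<^bsub>G\<^esub> x) ` T"]) auto
    then have "virtual_retract ?J (G Mod N)" using LR J unfolding property_LR_def by blast
    then show "virtual_retract H G"
      using virtual_retract_lift[OF assms(2) M(1,2,4,5) Y L H(1)] by blast
  qed
  ultimately show ?thesis by blast
qed

end
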